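(* Consider the discrete-time system $x(t+1)=Ax(t)+Bu(t)$, $t\in\mathbb{Z}_+$, with $x(t)\in\mathbb{R}^n$, $u(t)\in\mathbb{R}^m$, and $N$ agents with measurements $y_i(t)=C_ix(t)\in\mathbb{R}^{p_i}$, $i\in[1,N]$, communicating over a weighted digraph $\mathcal{G}=(\mathcal{V},\mathcal{E},\mathcal{A})$ with Laplacian $\mathcal{L}$. Here $A$ is in Jordan form with real eigenvalues, and all notation ($\lambda_\ell$, $r_u$, $A^{\ell,h_\ell}$, $d^{\ell,h_\ell}$, $C_i^{\ell,h_\ell}$, $\mathbb{G}_{i,k}^\ell$, $t_i^{\ell,h_\ell}$, $\mathcal{V}_3^{\ell,h_\ell}$, $\mathcal{L}^{\ell,h_\ell}$, and the observer structure) is as described in the context. Assume: (A1) the pair $\left(A,\begin{bmatrix}C_1\\ \vdots\\ C_N\end{bmatrix}\right)$ is detectable; (A2) for every $i\in[1,N]$ and every $\ell\in[1,r_u]$, the set of vectors $\{C_i^{\ell,h_\ell}\mathbb{e}_{t_i^{\ell,h_\ell}}\}_{h_\ell\in\mathbb{G}_{i,2}^\ell}\cup\{C_i^{\ell,h_\ell}\mathbb{e}_1\}_{h_\ell\in\mathbb{G}_{i,3}^\ell}$ is linearly independent. Then there exists a distributed observer of the form described in the context (i.e., there exist matrices $L_{i,d}$, $i\in[1,N]$, and real scalars $k^{\ell,h_\ell}$ such that, for all initial conditions of system and observers and all inputs $u$, the estimation errors $e_i(t)=x(t)-\hat x_i(t)$ satisfy $\lim_{t\to+\infty}e_i(t)=\mathbb{0}$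 for every $i\in[1,N]$) if and only if for every $\ell\in[1,r_u]$ and every $h_\ell\in[1,g_\ell]$ there exists $k^{\ell,h_\ell}\in\mathbb{R}$ such that $$|1-k^{\ell,h_\ell}\mu|<\frac{1}{|\lambda_\ell|}\qquad\text{for all }\mu\in\sigma(\mathcal{L}^{\ell,h_\ell}).$$
   Context: Digraph: $\mathcal{V}=[1,N]$, $\mathcal{A}\in\mathbb{R}^{N\times N}$ nonnegative with $[\mathcal{A}]_{i,j}>0$ iff $(j,i)\in\mathcal{E}$, $[\mathcal{A}]_{i,i}=0$; $\mathcal{N}_i=\{j:(j,i)\in\mathcal{E}\}$; $\mathcal{L}=\mathcal{D}-\mathcal{A}$ with $\mathcal{D}=\mathrm{diag}\{\sum_j[\mathcal{A}]_{i,j}\}_{i}$. $\sigma(M)$ denotes the spectrum; $\mathbb{e}_k$ is the $k$-th canonical vector. Structure of $A$: $A=\mathrm{diag}\{A^\ell\}_{\ell\in[1,r]}$, where $\lambda_1,\dots,\lambda_r$ are the distinct (real) eigenvalues, ordered so that $|\lambda_\ell|\ge1$ for $\ell\in[1,r_u]$ and $|\lambda_\ell|<1$ for $\ell\in[r_u+1,r]$; $A^\ell=\mathrm{diag}\{A^{\ell,h_\ell}\}_{h_\ell\in[1,g_\ell]}$ ($g_\ell$ the geometric multiplicity), and each Jordan miniblock $A^{\ell,h_\ell}\in\mathbb{R}^{d^{\ell,h_\ell}\times d^{\ell,h_\ell}}$ has $\lambda_\ell$ on the diagonal, $1$ on the superdiagonal and zeros elsewhere. The state is partitioned accordingly as $x=\mathrm{col}\{x^{\ell,h_\ell}\}$,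 the rows of $B$ as $B^{\ell,h_\ell}$, and the columns of $C_i$ as blocks $C_i^{\ell,h_\ell}\in\mathbb{R}^{p_i\times d^{\ell,h_\ell}}$. For $i\in[1,N]$, $\ell\in[1,r_u]$: $\mathbb{G}_{i,1}^\ell=\{h_\ell: C_i^{\ell,h_\ell}=\mathbb{0}\}$, $\mathbb{G}_{i,2}^\ell=\{h_\ell: C_i^{\ell,h_\ell}\mathbb{e}_1=\mathbb{0},\ C_i^{\ell,h_\ell}\neq\mathbb{0}\}$, $\mathbb{G}_{i,3}^\ell=\{h_\ell: C_i^{\ell,h_\ell}\mathbb{e}_1\neq\mathbb{0}\}$. For $h_\ell\in\mathbb{G}_{i,2}^\ell$, $t_i^{\ell,h_\ell}\in[2,d^{\ell,h_\ell}]$ is the index of the first nonzero column of $C_i^{\ell,h_\ell}$. For $\ell\in[1,r_u]$, $h_\ell\in[1,g_\ell]$: $\mathcal{V}_3^{\ell,h_\ell}=\{i\in[1,N]: h_\ell\in\mathbb{G}_{i,3}^\ell\}$, and $\mathcal{L}^{\ell,h_\ell}$ is the matrix obtained from $\mathcal{L}$ by deleting the rows and columns indexed in $\mathcal{V}_3^{\ell,h_\ell}$ (if this matrix is empty the condition is vacuous). Observer structure. For agent $i$, let $z_{i,d}$ be the subvector of $x$ consisting of: the last $d^{\ell,h_\ell}-t_i^{\ell,h_\ell}+1$ entries of $x^{\ell,h_\ell}$ for $\ell\le r_u$, $h_\ell\in\mathbb{G}_{i,2}^\ell$; all of $x^{\ell,h_\ell}$ for $\ell\le r_u$, $h_\ell\in\mathbb{G}_{i,3}^\ell$;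 and all of $x^\ell$ for $\ell>r_u$. Let $F_{i,d}$, $G_{i,d}$, $H_{i,d}$ be the corresponding principal submatrix of $A$, rows of $B$, and columns of $C_i$ (so $z_{i,d}(t+1)=F_{i,d}z_{i,d}(t)+G_{i,d}u(t)$, $y_i=H_{i,d}z_{i,d}$). Agent $i$ runs $\hat z_{i,d}(t+1)=F_{i,d}\hat z_{i,d}(t)+G_{i,d}u(t)+L_{i,d}(y_i(t)-H_{i,d}\hat z_{i,d}(t))$ with a gain matrix $L_{i,d}$, and its estimate $\hat x_i^{\ell,h_\ell}(t)$ of $x^{\ell,h_\ell}(t)$ for $\ell\le r_u$, $h_\ell\in\mathbb{G}_{i,3}^\ell$, and of $x^\ell(t)$ for $\ell>r_u$, is the corresponding subvector of $\hat z_{i,d}(t)$. For every $\ell\le r_u$ and $h_\ell\in\mathbb{G}_{i,1}^\ell\cup\mathbb{G}_{i,2}^\ell$, agent $i$ runs $\hat x_i^{\ell,h_\ell}(t+1)=A^{\ell,h_\ell}\hat x_i^{\ell,h_\ell}(t)+B^{\ell,h_\ell}u(t)+k^{\ell,h_\ell}A^{\ell,h_\ell}\sum_{j\in\mathcal{N}_i}[\mathcal{A}]_{i,j}(\hat x_j^{\ell,h_\ell}(t)-\hat x_i^{\ell,h_\ell}(t))$, where $k^{\ell,h_\ell}\in\mathbb{R}$ is a scalar gain common to all agents, and $\hat x_j^{\ell,h_\ell}$ is agent $j$'s estimate of $x^{\ell,h_\ell}$ (from either of its two observers). The full estimate $\hat x_i(t)$ stacks all these blocks $\hat x_i^{\ell,h_\ell}(t)$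 (and $\hat x_i^\ell(t)$ for stable $\ell$) in the order of $x$. *)

theory Defs
  imports Complex_Main "Jordan_Normal_Form.Char_Poly"
begin

text \<open>
Conventions (all indices 0-based).  The distinct eigenvalues of the Jordan-form
matrix A are lam 0, ..., lam (r-1); eigenvalue l has g l Jordan miniblocks, the
miniblock (l,h) has size d l h.  A state coordinate is a triple (l,h,k) with
l < r, h < g l, k < d l h: the k-th entry of the sub-vector x^{l,h}.
A state vector is a function on such triples; the Jordan-form matrix A acts by
(A v)(l,h,k) = lam l * v(l,h,k) + v(l,h,k+1) (the last term only if k+1 < d l h).
The unstable eigenvalues are those with l < ru.
Agents are 0, ..., N-1; Cm i q j is entry (q,j) of C_i (q < p i);
Bm j c is entry (j,c) of B (c < m); Adj i j is the weight [\<A>]_{i,j}.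
\<close>

type_synonym idx = "nat \<times> nat \<times> nat"

definition coords :: "nat \<Rightarrow> (nat \<Rightarrow> nat) \<Rightarrow> (nat \<Rightarrow> nat \<Rightarrow> nat) \<Rightarrow> idx set" where
  "coords r g d = {(l,h,k). l < r \<and> h < g l \<and> k < d l h}"

definition jordan_apply ::
  "(nat \<Rightarrow> real) \<Rightarrow> (nat \<Rightarrow> nat \<Rightarrow> nat) \<Rightarrow> (idx \<Rightarrow> 'a::real_algebra_1) \<Rightarrow> idx \<Rightarrow> 'a" where
  "jordan_apply lam d v = (\<lambda>(l,h,k). of_real (lam l) * v (l,h,k)
       + (if Suc k < d l h then v (l,h,Suc k) else 0))"

definition jordan_structure ::
  "nat \<Rightarrow> nat \<Rightarrow> (nat \<Rightarrow> real) \<Rightarrow> (nat \<Rightarrow> nat) \<Rightarrow> (nat \<Rightarrow> nat \<Rightarrow> nat) \<Rightarrow> bool" where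
  "jordan_structure r ru lam g d \<longleftrightarrow>
     ru \<le> r \<and> inj_on lam {..<r} \<and> (\<forall>l<r. 1 \<le> g l) \<and>
     (\<forall>l<r. \<forall>h<g l. 1 \<le> d l h) \<and> (\<forall>l<r. 1 \<le> \<bar>lam l\<bar> \<longleftrightarrow> l < ru)"

definition weighted_digraph :: "nat \<Rightarrow> (nat \<Rightarrow> nat \<Rightarrow> real) \<Rightarrow> bool" where
  "weighted_digraph N Adj \<longleftrightarrow> (\<forall>i<N. \<forall>j<N. 0 \<le> Adj i j) \<and> (\<forall>i<N. Adj i i = 0)"

definition laplacian :: "nat \<Rightarrow> (nat \<Rightarrow> nat \<Rightarrow> real) \<Rightarrow> nat \<Rightarrow> nat \<Rightarrow> real" where
  "laplacian N Adj i j = (if i = j then (\<Sum>a<N. Adj i a) else 0) - Adj i j"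

definition detectable ::
  "nat \<Rightarrow> (nat \<Rightarrow> real) \<Rightarrow> (nat \<Rightarrow> nat) \<Rightarrow> (nat \<Rightarrow> nat \<Rightarrow> nat) \<Rightarrow>
   nat \<Rightarrow> (nat \<Rightarrow> nat) \<Rightarrow> (nat \<Rightarrow> nat \<Rightarrow> idx \<Rightarrow> real) \<Rightarrow> bool" where
  "detectable r lam g d N p Cm \<longleftrightarrow>
     (\<forall>(\<mu>::complex) (v::idx \<Rightarrow> complex).
        (\<forall>j\<in>coords r g d. jordan_apply lam d v j = \<mu> * v j) \<and>
        (\<forall>i<N. \<forall>q<p i. (\<Sum>j\<in>coords r g d. of_real (Cm i q j) * v j) = 0) \<and>
        (\<exists>j\<in>coords r g d. v j \<noteq> 0)
        \<longrightarrow> cmod \<mu> < 1)"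

definition G1 :: "(nat \<Rightarrow> nat) \<Rightarrow> (nat \<Rightarrow> nat \<Rightarrow> nat) \<Rightarrow> (nat \<Rightarrow> nat) \<Rightarrow> (nat \<Rightarrow> nat \<Rightarrow> idx \<Rightarrow> real)
    \<Rightarrow> nat \<Rightarrow> nat \<Rightarrow> nat set" where
  "G1 gl d p Cm i l = {h. h < gl l \<and> (\<forall>q<p i. \<forall>k<d l h. Cm i q (l,h,k) = 0)}"

definition G3 :: "(nat \<Rightarrow> nat) \<Rightarrow> (nat \<Rightarrow> nat \<Rightarrow> nat) \<Rightarrow> (nat \<Rightarrow> nat) \<Rightarrow> (nat \<Rightarrow> nat \<Rightarrow> idx \<Rightarrow> real)
    \<Rightarrow> nat \<Rightarrow> nat \<Rightarrow> nat set" where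
  "G3 gl d p Cm i l = {h. h < gl l \<and> (\<exists>q<p i. Cm i q (l,h,0) \<noteq> 0)}"

definition G2 :: "(nat \<Rightarrow> nat) \<Rightarrow> (nat \<Rightarrow> nat \<Rightarrow> nat) \<Rightarrow> (nat \<Rightarrow> nat) \<Rightarrow> (nat \<Rightarrow> nat \<Rightarrow> idx \<Rightarrow> real)
    \<Rightarrow> nat \<Rightarrow> nat \<Rightarrow> nat set" where
  "G2 gl d p Cm i l = {h. h < gl l \<and> (\<forall>q<p i. Cm i q (l,h,0) = 0) \<and>
                         (\<exists>q<p i. \<exists>k<d l h. Cm i q (l,h,k) \<noteq> 0)}"

definition tidx :: "(nat \<Rightarrow> nat) \<Rightarrow> (nat \<Rightarrow> nat \<Rightarrow> idx \<Rightarrow> real) \<Rightarrow> nat \<Rightarrow> nat \<Rightarrow> nat \<Rightarrow> nat" where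
  "tidx p Cm i l h = (LEAST k. \<exists>q<p i. Cm i q (l,h,k) \<noteq> 0)"

definition lin_indep_family :: "nat \<Rightarrow> 'b set \<Rightarrow> ('b \<Rightarrow> nat \<Rightarrow> real) \<Rightarrow> bool" where
  "lin_indep_family n H vs \<longleftrightarrow>
     (\<forall>c. (\<forall>q<n. (\<Sum>h\<in>H. c h * vs h q) = 0) \<longrightarrow> (\<forall>h\<in>H. c h = 0))"

definition Zset :: "nat \<Rightarrow> nat \<Rightarrow> (nat \<Rightarrow> nat) \<Rightarrow> (nat \<Rightarrow> nat \<Rightarrow> nat) \<Rightarrow> (nat \<Rightarrow> nat)
    \<Rightarrow> (nat \<Rightarrow> nat \<Rightarrow> idx \<Rightarrow> real) \<Rightarrow> nat \<Rightarrow> idx set" where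
  "Zset r ru g d p Cm i = {(l,h,k). (l,h,k) \<in> coords r g d \<and>
      ((l < ru \<and> h \<in> G2 g d p Cm i l \<and> tidx p Cm i l h \<le> k) \<or>
       (l < ru \<and> h \<in> G3 g d p Cm i l) \<or> ru \<le> l)}"

text \<open>The full estimate of agent i: consensus-observer state w on blocks (l,h) with
  l < ru, h in G1 \<union> G2; Luenberger-observer state zh otherwise.\<close>
definition est :: "nat \<Rightarrow> (nat \<Rightarrow> nat) \<Rightarrow> (nat \<Rightarrow> nat \<Rightarrow> nat) \<Rightarrow> (nat \<Rightarrow> nat)
    \<Rightarrow> (nat \<Rightarrow> nat \<Rightarrow> idx \<Rightarrow> real)
    \<Rightarrow> (nat \<Rightarrow> nat \<Rightarrow> idx \<Rightarrow> real) \<Rightarrow> (nat \<Rightarrow> nat \<Rightarrow> idx \<Rightarrow> real)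
    \<Rightarrow> nat \<Rightarrow> nat \<Rightarrow> idx \<Rightarrow> real" where
  "est ru g d p Cm zh w i t = (\<lambda>(l,h,k).
      if l < ru \<and> h \<notin> G3 g d p Cm i l then w i t (l,h,k) else zh i t (l,h,k))"

text \<open>Closed-loop equations of plant + distributed observer, with gains Lg, kg.
  x: plant state, u: input, zh i: state hat z_{i,d} of agent i (meaningful on Zset i),
  w i: consensus-observer states of agent i (meaningful on the blocks l<ru, h in G1\<union>G2).\<close>
definition closed_loop ::
  "nat \<Rightarrow> nat \<Rightarrow> (nat \<Rightarrow> real) \<Rightarrow> (nat \<Rightarrow> nat) \<Rightarrow> (nat \<Rightarrow> nat \<Rightarrow> nat) \<Rightarrow>
   nat \<Rightarrow> (idx \<Rightarrow> nat \<Rightarrow> real) \<Rightarrow> nat \<Rightarrow> (nat \<Rightarrow> nat) \<Rightarrow> (nat \<Rightarrow> nat \<Rightarrow> idx \<Rightarrow> real) \<Rightarrow>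
   (nat \<Rightarrow> nat \<Rightarrow> real) \<Rightarrow>
   (nat \<Rightarrow> idx \<Rightarrow> nat \<Rightarrow> real) \<Rightarrow> (nat \<Rightarrow> nat \<Rightarrow> real) \<Rightarrow>
   (nat \<Rightarrow> idx \<Rightarrow> real) \<Rightarrow> (nat \<Rightarrow> nat \<Rightarrow> real) \<Rightarrow>
   (nat \<Rightarrow> nat \<Rightarrow> idx \<Rightarrow> real) \<Rightarrow> (nat \<Rightarrow> nat \<Rightarrow> idx \<Rightarrow> real) \<Rightarrow> bool" where
  "closed_loop r ru lam g d m Bm N p Cm Adj Lg kg x u zh w \<longleftrightarrow>
     (\<forall>t. \<forall>j\<in>coords r g d.
        x (Suc t) j = jordan_apply lam d (x t) j + (\<Sum>c<m. Bm j c * u t c)) \<and>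
     (\<forall>i<N. \<forall>t. \<forall>j\<in>Zset r ru g d p Cm i.
        zh i (Suc t) j = jordan_apply lam d (zh i t) j + (\<Sum>c<m. Bm j c * u t c)
          + (\<Sum>q<p i. Lg i j q *
               ((\<Sum>j'\<in>coords r g d. Cm i q j' * x t j')
                 - (\<Sum>j'\<in>Zset r ru g d p Cm i. Cm i q j' * zh i t j')))) \<and>
     (\<forall>i<N. \<forall>t. \<forall>l<ru. \<forall>h<g l. h \<notin> G3 g d p Cm i l \<longrightarrow> (\<forall>k<d l h.
        w i (Suc t) (l,h,k) = jordan_apply lam d (w i t) (l,h,k) + (\<Sum>c<m. Bm (l,h,k) c * u t c)
          + kg l h * jordan_apply lam d
              (\<lambda>j'. \<Sum>a<N. Adj i a * (est ru g d p Cm zh w a t j' - w i t j')) (l,h,k)))"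

definition V3 :: "(nat \<Rightarrow> nat) \<Rightarrow> (nat \<Rightarrow> nat \<Rightarrow> nat) \<Rightarrow> (nat \<Rightarrow> nat) \<Rightarrow> (nat \<Rightarrow> nat \<Rightarrow> idx \<Rightarrow> real)
   \<Rightarrow> nat \<Rightarrow> nat \<Rightarrow> nat \<Rightarrow> nat set" where
  "V3 g d p Cm N l h = {i. i < N \<and> h \<in> G3 g d p Cm i l}"

definition reduced_laplacian :: "nat \<Rightarrow> (nat \<Rightarrow> nat \<Rightarrow> real) \<Rightarrow> nat set \<Rightarrow> real mat" where
  "reduced_laplacian N Adj V = (let s = sorted_list_of_set ({..<N} - V) in
     mat (length s) (length s) (\<lambda>(a,b). laplacian N Adj (s ! a) (s ! b)))"

definition spec :: "real mat \<Rightarrow> complex set" where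
  "spec M = {\<mu>. eigenvalue (map_mat complex_of_real M) \<mu>}"

end

theory Submission
  imports Defs "Jordan_Normal_Form.Schur_Decomposition"
begin

text \<open>
  The local pairs \<open>(F_{i,d}, H_{i,d})\<close> are detectable because of (A2), and since all eigenvalues
  are real, a stabilizing gain is obtained by moving the unstable eigenvalues to 0 one at a time.
  Hence the errors of the Luenberger observers vanish for suitable \<open>L_{i,d}\<close>.
  On a block \<open>(l,h)\<close> the errors of the agents outside \<open>V3\<close> evolve by
  \<open>(I - k \<L>\<^sup>l\<^sup>h) \<otimes> A\<^sup>l\<^sup>h\<close>, driven by the vanishing errors of the agents in \<open>V3\<close>. Along the Jordan
  chain this is a cascade of recursions with matrix \<open>\<lambda>\<^sub>l (I - k \<L>\<^sup>l\<^sup>h)\<close>, which is Schur stable exactly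
  under the spectral condition; conversely, an eigenvector violating that condition yields
  an error trajectory on the leading entries of the block that does not vanish.
\<close>

section \<open>Stable linear recursions driven by vanishing inputs\<close>

text \<open>From the time \<open>T\<close> at which the input is small, the geometric series limits
  its accumulated effect to half of \<open>\<epsilon>\<close>, while the contribution of
  \<open>f T\<close> decays like \<open>norm a ^ s\<close>.\<close>

lemma scalar_recursion_tendsto_zero:
  fixes f c :: "nat \<Rightarrow> 'a::real_normed_field"
  assumes a: "norm a < 1" and c: "c \<longlonglongrightarrow> 0"
    and rec: "\<And>t. f (Suc t) = a * f t + c t"
  shows "f \<longlonglongrightarrow> 0"
proof (rule LIMSEQ_I)
  fix \<epsilon> :: real
  assume "0 < \<epsilon>"
  \<comment> \<open>Chosen so that
    \<open>norm a * (\<epsilon> / 2) + \<delta> = \<epsilon> / 2\<close>: the constant term of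
    \<open>bound\<close> then reproduces itself in the induction.\<close>
  define \<delta> where "\<delta> = \<epsilon> / 2 * (1 - norm a)"
  have "0 < \<delta>" using a \<open>0 < \<epsilon>\<close> by (simp add: \<delta>_def)
  then obtain T where T: "\<And>t. t \<ge> T \<Longrightarrow> norm (c t) < \<delta>"
    using LIMSEQ_D[OF c] by auto
  have bound: "norm (f (T + s)) \<le> norm a ^ s * norm (f T) + \<epsilon> / 2" for s
  proof (induction s)
    case 0
    show ?case using \<open>0 < \<epsilon>\<close> by simp
  next
    case (Suc s)
    have "norm (f (T + Suc s)) \<le> norm a * norm (f (T + s)) + norm (c (T + s))"
      using norm_triangle_ineq[of "a * f (T + s)" "c (T + s)"] by (simp add: rec norm_mult)
    also have "\<dots> \<le> norm a * (norm a ^ s * norm (f T) + \<epsilon> / 2) + \<delta>"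
      using Suc T[of "T + s"] by (intro add_mono mult_left_mono) auto
    also have "\<dots> = norm a ^ Suc s * norm (f T) + \<epsilon> / 2"
      by (simp add: \<delta>_def field_simps)
    finally show ?case .
  qed
  have "(\<lambda>s. norm a ^ s * norm (f T)) \<longlonglongrightarrow> 0"
    using a by (intro tendsto_mult_left_zero LIMSEQ_power_zero) auto
  from LIMSEQ_D[OF this, of "\<epsilon> / 2"] \<open>0 < \<epsilon>\<close>
  obtain S where S: "\<And>s. s \<ge> S \<Longrightarrow> norm a ^ s * norm (f T) < \<epsilon> / 2"
    by auto
  have "norm (f t - 0) < \<epsilon>" if "t \<ge> T + S" for t
  proof -
    have "T \<le> t" "S \<le> t - T" using that by auto
    then show ?thesis using bound[of "t - T"] S[of "t - T"] by simp
  qed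
  then show "\<exists>no. \<forall>t\<ge>no. norm (f t - 0) < \<epsilon>" by blast
qed

text \<open>A complex Schur form makes the system triangular with the eigenvalues on the diagonal,
  so it splits into scalar recursions. They are solved from the last coordinate upwards, the
  coordinates already shown to vanish being part of the input.\<close>

lemma perturbed_linear_recursion_tendsto_zero:
  fixes M :: "real mat" and e b :: "nat \<Rightarrow> nat \<Rightarrow> real"
  assumes M: "M \<in> carrier_mat n n"
    and eig: "\<And>\<mu>. eigenvalue (map_mat complex_of_real M) \<mu> \<Longrightarrow> cmod \<mu> < 1"
    and rec: "\<And>t i. i < n \<Longrightarrow> e (Suc t) i = (\<Sum>j<n. M $$ (i,j) * e t j) + b t i"
    and b: "\<And>i. i < n \<Longrightarrow> (\<lambda>t. b t i) \<longlonglongrightarrow> 0"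
    and "i < n"
  shows "(\<lambda>t. e t i) \<longlonglongrightarrow> 0"
proof -
  define A where "A = map_mat complex_of_real M"
  have A: "A \<in> carrier_mat n n" using M by (simp add: A_def)
  obtain es where es: "char_poly A = (\<Prod>a\<leftarrow>es. [:- a, 1:])"
    using char_poly_factorized[OF A] by blast
  obtain B P Q where "schur_decomposition A es = (B, P, Q)"
    using prod_cases3 by blast
  from schur_decomposition[OF A es this]
  have wit: "similar_mat_wit A B P Q" and ut: "upper_triangular B" and diag: "diag_mat B = es"
    by auto
  note w = similar_mat_witD2[OF A wit]
  note B = w(5) and P = w(6) and Q = w(7)
  have diag_less: "cmod (B $$ (i,i)) < 1" if "i < n" for i
  proof -
    have "B $$ (i,i) \<in> set es" using that B unfolding diag[symmetric] diag_mat_def by auto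
    then have "poly (char_poly A) (B $$ (i,i)) = 0" unfolding es by (rule linear_poly_root)
    then show ?thesis using eig eigenvalue_root_char_poly[OF A] by (simp add: A_def)
  qed
  define E where "E t = vec n (\<lambda>i. complex_of_real (e t i))" for t
  define D where "D t = vec n (\<lambda>i. complex_of_real (b t i))" for t
  \<comment> \<open>The state in the triangularizing basis; \<open>Q\<close> is the inverse of
    \<open>P\<close>, so the recursion for \<open>F\<close> has matrix \<open>B\<close>.\<close>
  define F where "F t = Q *\<^sub>v E t" for t
  have Ec [simp]: "E t \<in> carrier_vec n" and Dc [simp]: "D t \<in> carrier_vec n" for t
    by (simp_all add: E_def D_def)
  have Fc [simp]: "F t \<in> carrier_vec n" for t using Q by (simp add: F_def)
  then have [simp]: "dim_vec (F t) = n" for t by (rule carrier_vecD)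
  have Erec: "E (Suc t) = A *\<^sub>v E t + D t" for t
    using M by (intro eq_vecI)
      (auto simp: E_def D_def A_def rec scalar_prod_def lessThan_atLeast0 intro!: sum.cong)
  have "Q * A = B * Q"
  proof -
    have "Q * A = Q * (P * (B * Q))" using w(3) B P Q by simp
    also have "\<dots> = (Q * P) * (B * Q)" using B P Q by (subst assoc_mult_mat) auto
    finally show ?thesis using w(2) B Q by simp
  qed
  then have Frec: "F (Suc t) = B *\<^sub>v F t + Q *\<^sub>v D t" for t
    using A B Q unfolding F_def Erec
    by (simp add: mult_add_distrib_mat_vec[where nr=n and nc=n] flip: assoc_mult_mat_vec)
  have Dlim: "(\<lambda>t. (Q *\<^sub>v D t) $ i) \<longlonglongrightarrow> 0" if "i < n" for i
  proof -
    have "(\<lambda>t. \<Sum>j<n. Q $$ (i,j) * complex_of_real (b t j)) \<longlonglongrightarrow> 0"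
      using b by (intro tendsto_null_sum tendsto_mult_right_zero)
        (auto simp: tendsto_of_real_iff[of _ 0, simplified])
    moreover have "(Q *\<^sub>v D t) $ i = (\<Sum>j<n. Q $$ (i,j) * complex_of_real (b t j))" for t
      using that Q by (auto simp: D_def scalar_prod_def lessThan_atLeast0 intro!: sum.cong)
    ultimately show ?thesis by simp
  qed
  have Flim: "(\<lambda>t. F t $ i) \<longlonglongrightarrow> 0" if "i < n" for i
    using that
  proof (induction "n - i" arbitrary: i rule: less_induct)
    case less
    \<comment> \<open>Row \<open>i\<close> of an upper triangular matrix involves only
      \<open>j \<ge> i\<close>; everything beyond the diagonal term vanishes by induction.\<close>
    define c where "c t = (\<Sum>j=Suc i..<n. B $$ (i,j) * F t $ j) + (Q *\<^sub>v D t) $ i" for t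
    have "(\<lambda>t. \<Sum>j=Suc i..<n. B $$ (i,j) * F t $ j) \<longlonglongrightarrow> 0"
      using less by (intro tendsto_null_sum tendsto_mult_right_zero) auto
    then have "c \<longlonglongrightarrow> 0"
      unfolding c_def using Dlim[OF less.prems] by (intro tendsto_add_zero)
    moreover have "F (Suc t) $ i = B $$ (i,i) * F t $ i + c t" for t
    proof -
      have "F (Suc t) $ i = (\<Sum>j=0..<n. B $$ (i,j) * F t $ j) + (Q *\<^sub>v D t) $ i"
        unfolding Frec using less.prems B Q Fc[of t]
        by (auto simp: scalar_prod_def intro!: sum.cong)
      also have "(\<Sum>j=0..<n. B $$ (i,j) * F t $ j) = (\<Sum>j=i..<n. B $$ (i,j) * F t $ j)"
        using ut less.prems B by (intro sum.mono_neutral_right) (auto simp: upper_triangular_def)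
      also have "\<dots> = B $$ (i,i) * F t $ i + (\<Sum>j=Suc i..<n. B $$ (i,j) * F t $ j)"
        using less.prems by (simp add: sum.atLeast_Suc_lessThan)
      finally show ?thesis by (simp add: c_def)
    qed
    ultimately show ?case
      by (rule scalar_recursion_tendsto_zero[OF diag_less[OF less.prems]])
  qed
  have EPF: "E t = P *\<^sub>v F t" for t
  proof -
    have "P *\<^sub>v F t = (P * Q) *\<^sub>v E t" using P Q by (simp add: F_def)
    then show ?thesis by (simp add: w(1))
  qed
  have "complex_of_real (e t i) = (\<Sum>j<n. P $$ (i,j) * F t $ j)" for t
  proof -
    have "complex_of_real (e t i) = E t $ i" using \<open>i < n\<close> by (simp add: E_def)
    also have "\<dots> = (P *\<^sub>v F t) $ i" by (simp only: EPF)
    also have "\<dots> = (\<Sum>j<n. P $$ (i,j) * F t $ j)"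
      using \<open>i < n\<close> P by (auto simp: scalar_prod_def lessThan_atLeast0 intro!: sum.cong)
    finally show ?thesis .
  qed
  moreover have "(\<lambda>t. \<Sum>j<n. P $$ (i,j) * F t $ j) \<longlonglongrightarrow> 0"
    using Flim by (intro tendsto_null_sum tendsto_mult_right_zero) auto
  ultimately have "(\<lambda>t. complex_of_real (e t i)) \<longlonglongrightarrow> complex_of_real 0" by simp
  then show ?thesis by (simp only: tendsto_of_real_iff)
qed

section \<open>Stabilization by output injection and split spectra\<close>

text \<open>Each step of the induction uses a rank-one injection along an eigenvector of an eigenvalue
  outside the unit disc: it moves that eigenvalue to 0 and leaves the others in place.\<close>

lemma stabilizing_output_injection:
  fixes F H :: "real mat"
  assumes F: "F \<in> carrier_mat n n" and H: "H \<in> carrier_mat p n"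
    and cp: "char_poly F = (\<Prod>a\<leftarrow>es. [:- a, 1:])"
    and pbh: "\<And>a v. 1 \<le> \<bar>a\<bar> \<Longrightarrow> v \<in> carrier_vec n \<Longrightarrow> F *\<^sub>v v = a \<cdot>\<^sub>v v \<Longrightarrow>
                H *\<^sub>v v = 0\<^sub>v p \<Longrightarrow> v = 0\<^sub>v n"
  shows "\<exists>L \<in> carrier_mat n p. \<exists>es'. char_poly (F - L * H) = (\<Prod>a\<leftarrow>es'. [:- a, 1:]) \<and>
           (\<forall>a\<in>set es'. \<bar>a\<bar> < 1)"
  using F cp pbh
proof (induction "length (filter (\<lambda>a. 1 \<le> \<bar>a\<bar>) es)" arbitrary: es F)
  case 0
  then have "\<forall>a\<in>set es. \<bar>a\<bar> < 1" by (auto simp: filter_empty_conv)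
  moreover have "F - 0\<^sub>m n p * H = F" using 0 H by auto
  ultimately show ?case using 0 by (intro bexI[of _ "0\<^sub>m n p"] exI[of _ es]) auto
next
  case (Suc m)
  note F = Suc.prems(1) and pbh = Suc.prems(3)
  from Suc.hyps(2) obtain a where a: "a \<in> set es" "1 \<le> \<bar>a\<bar>"
    by (metis (mono_tags, lifting) filter_empty_conv list.size(3) nat.distinct(1))
  define es1 where "es1 = remove1 a es"
  \<comment> \<open>With \<open>a\<close> first in the list, the Schur form carries it in its upper
    left corner.\<close>
  have cp: "char_poly F = (\<Prod>a\<leftarrow>a # es1. [:- a, 1:])"
    using Suc.prems(2) a prod_list_map_remove1[of a es "\<lambda>a. [:- a, 1:]"] by (simp add: es1_def)
  have m: "m = length (filter (\<lambda>a. 1 \<le> \<bar>a\<bar>) es1)"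
    using Suc.hyps(2) a by (simp add: es1_def filter_remove1 length_remove1)
  obtain B P Q where "schur_decomposition F (a # es1) = (B, P, Q)"
    using prod_cases3 by blast
  from schur_decomposition[OF F cp this]
  have wit: "similar_mat_wit F B P Q" and ut: "upper_triangular B"
    and diag: "diag_mat B = a # es1"
    by auto
  note w = similar_mat_witD2[OF F wit]
  note B = w(5) and P = w(6) and Q = w(7)
  have len: "n = Suc (length es1)" using arg_cong[OF diag, of length] B by (simp add: diag_mat_def)
  have diag_nth: "B $$ (i,i) = (a # es1) ! i" if "i < n" for i
    using that B unfolding diag[symmetric] diag_mat_def by simp
  \<comment> \<open>The first column of \<open>B\<close> is \<open>a\<close> times the first unit
    vector, so \<open>F * P = P * B\<close> makes this column of \<open>P\<close> an eigenvector for
    \<open>a\<close>.\<close>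
  define v where "v = col P 0"
  have v: "v \<in> carrier_vec n" using P by (intro carrier_vecI) (simp add: v_def)
  have FP: "F * P = P * B"
  proof -
    have "F * P = P * B * (Q * P)"
      unfolding w(3) using B P Q by (intro assoc_mult_mat[where n\<^sub>2=n and n\<^sub>3=n]) auto
    then show ?thesis using w(2) B by simp
  qed
  have "col B 0 = a \<cdot>\<^sub>v unit_vec n 0"
    using B ut len diag_nth[of 0] by (intro eq_vecI) (auto simp: upper_triangular_def)
  moreover have "P *\<^sub>v unit_vec n 0 = v"
    using P len scalar_prod_right_unit[of 0 n] by (intro eq_vecI) (auto simp: v_def)
  ultimately have "P *\<^sub>v col B 0 = a \<cdot>\<^sub>v v" using P by (simp add: mult_mat_vec)
  moreover have "F *\<^sub>v v = col (F * P) 0"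
    unfolding v_def by (rule col_mult2[OF F P, symmetric]) (simp add: len)
  moreover have "col (P * B) 0 = P *\<^sub>v col B 0"
    by (rule col_mult2[OF P B]) (simp add: len)
  ultimately have Fv: "F *\<^sub>v v = a \<cdot>\<^sub>v v" by (simp only: FP)
  have "v \<noteq> 0\<^sub>v n"
  proof
    assume "v = 0\<^sub>v n"
    then have "col (Q * P) 0 = 0\<^sub>v n" using P Q len by (intro eq_vecI) (auto simp: v_def)
    then have "col (1\<^sub>m n) 0 = (0\<^sub>v n :: real vec)" using w(2) by simp
    then have "unit_vec n 0 $ 0 = (0\<^sub>v n :: real vec) $ 0" using len by simp
    then show False using len by simp
  qed
  then have "H *\<^sub>v v \<noteq> 0\<^sub>v p" using pbh[OF a(2) v Fv] by blast
  then obtain q where q: "q < p" "(H *\<^sub>v v) $ q \<noteq> 0"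
    using H by (metis (no_types, lifting) dim_mult_mat_vec carrier_matD(1) eq_vecI index_zero_vec)
  \<comment> \<open>In the basis \<open>P\<close> the injection alters only row 0 of
    \<open>B\<close>, which keeps it triangular. Since \<open>(H * P) $$ (q,0)\<close> equals
    \<open>(H *\<^sub>v v) $ q\<close>, the corner entry becomes \<open>a - a = 0\<close>; the
    hypothesis \<open>pbh\<close> supplies an output \<open>q\<close> for which the denominator is
    nonzero.\<close>
  define K where "K = mat n p (\<lambda>(i,j). if i = 0 \<and> j = q then a / (H *\<^sub>v v) $ q else 0)"
  have K: "K \<in> carrier_mat n p" by (simp add: K_def)
  define B1 where "B1 = B - K * (H * P)"
  have HP: "H * P \<in> carrier_mat p n" using H P by simp
  have B1: "B1 \<in> carrier_mat n n" unfolding B1_def by (rule minus_carrier_mat[OF mult_carrier_mat[OF K HP]])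
  have KHP: "(K * (H * P)) $$ (i,j) = (if i = 0 then a / (H *\<^sub>v v) $ q * (H * P) $$ (q,j) else 0)"
    if "i < n" "j < n" for i j
  proof -
    have "(K * (H * P)) $$ (i,j) = (\<Sum>k=0..<p. K $$ (i,k) * (H * P) $$ (k,j))"
    proof -
      have "(K * X) $$ (i,j) = (\<Sum>k=0..<p. K $$ (i,k) * X $$ (k,j))" if "X \<in> carrier_mat p n" for X
        using \<open>i < n\<close> \<open>j < n\<close> K that by (simp add: scalar_prod_def)
      then show ?thesis using HP by blast
    qed
    also have "\<dots> = (\<Sum>k=0..<p. if k = q then (if i = 0 then a / (H *\<^sub>v v) $ q * (H * P) $$ (q,j) else 0) else 0)"
      using that by (intro sum.cong) (auto simp: K_def)
    finally show ?thesis using q by simp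
  qed
  have HP0: "(H * P) $$ (q,0) = (H *\<^sub>v v) $ q"
    using H P q len by (simp add: v_def)
  have B1_nth: "B1 $$ (i,j) = B $$ (i,j) - (if i = 0 then a / (H *\<^sub>v v) $ q * (H * P) $$ (q,j) else 0)"
    if "i < n" "j < n" for i j
    using that KHP[OF that] P K by (simp add: B1_def del: index_mult_mat(1))
  have ut1: "upper_triangular B1"
    using ut B B1 B1_nth by (auto simp: upper_triangular_def)
  have "diag_mat B1 = 0 # es1"
  proof (rule nth_equalityI)
    show "length (diag_mat B1) = length (0 # es1)" using B1 len by (simp add: diag_mat_def)
    fix i assume "i < length (diag_mat B1)"
    then have i: "i < n" using B1 by (simp add: diag_mat_def)
    then show "diag_mat B1 ! i = (0 # es1) ! i"
      using B1 diag_nth[OF i] q HP0 by (cases i) (auto simp: diag_mat_def B1_nth)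
  qed
  then have cp1: "char_poly B1 = (\<Prod>a\<leftarrow>0 # es1. [:- a, 1:])"
    using char_poly_upper_triangular[OF B1 ut1] by simp
  define F1 where "F1 = F - P * K * H"
  have F1: "F1 \<in> carrier_mat n n" 
    unfolding F1_def by (rule minus_carrier_mat[OF mult_carrier_mat[OF mult_carrier_mat[OF P K] H]])
  have "F1 = P * B1 * Q"
  proof -
    have "P * B1 * Q = P * B * Q - P * (K * (H * P)) * Q"
      unfolding B1_def using P B K HP Q
      by (simp add: mult_minus_distrib_mat[where nr=n and n=n and nc=n]
          minus_mult_distrib_mat[where nr=n and n=n and nc=n] del: assoc_mult_mat)
    also have "P * (K * (H * P)) * Q = P * K * H * (P * Q)"
      using assoc_mult_mat[OF mult_carrier_mat[OF mult_carrier_mat[OF P K] H] P Q]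
        assoc_mult_mat[OF P K HP] assoc_mult_mat[OF mult_carrier_mat[OF P K] H P] by simp
    finally show ?thesis using w(1,3) P K H by (simp add: F1_def)
  qed
  then have "similar_mat F1 B1"
    using F1 B1 P Q w(1,2) by (intro similar_matI[where n=n and P=P and Q=Q]) auto
  then have cpF1: "char_poly F1 = (\<Prod>a\<leftarrow>0 # es1. [:- a, 1:])"
    using cp1 char_poly_similar by metis
  have "\<exists>L \<in> carrier_mat n p. \<exists>es'. char_poly (F1 - L * H) = (\<Prod>a\<leftarrow>es'. [:- a, 1:]) \<and>
           (\<forall>a\<in>set es'. \<bar>a\<bar> < 1)"
  proof (rule Suc.hyps(1)[OF _ F1 cpF1])
    show "m = length (filter (\<lambda>a. 1 \<le> \<bar>a\<bar>) (0 # es1))" using m by simp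
  next
    fix c z
    assume c: "1 \<le> \<bar>c\<bar>" and z: "z \<in> carrier_vec n" and Fz: "F1 *\<^sub>v z = c \<cdot>\<^sub>v z"
      and Hz: "H *\<^sub>v z = 0\<^sub>v p"
    \<comment> \<open>The injection vanishes on the kernel of \<open>H\<close>, so an unobserved
      eigenvector of \<open>F1\<close> is one of \<open>F\<close> and the hypothesis
      \<open>pbh\<close> carries over.\<close>
    have "F1 *\<^sub>v z = F *\<^sub>v z - (P * K) *\<^sub>v (H *\<^sub>v z)"
      unfolding F1_def minus_mult_distrib_mat_vec[OF F mult_carrier_mat[OF mult_carrier_mat[OF P K] H] z]
        assoc_mult_mat_vec[OF mult_carrier_mat[OF P K] H z] ..
    moreover have "X *\<^sub>v 0\<^sub>v p = 0\<^sub>v n" if "X \<in> carrier_mat n p" for X :: "real mat"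
      using that by (intro eq_vecI) auto
    then have "(P * K) *\<^sub>v 0\<^sub>v p = 0\<^sub>v n" using P K by (metis mult_carrier_mat)
    ultimately have "F *\<^sub>v z = c \<cdot>\<^sub>v z" using Fz Hz F z by simp
    then show "z = 0\<^sub>v n" using pbh c z Hz by blast
  qed
  then obtain L es' where L: "L \<in> carrier_mat n p"
    and es': "char_poly (F1 - L * H) = (\<Prod>a\<leftarrow>es'. [:- a, 1:])" "\<forall>a\<in>set es'. \<bar>a\<bar> < 1"
    by blast
  \<comment> \<open>Successive injections through the same \<open>H\<close> add up to a single
    gain.\<close>
  have "F1 - L * H = F - (P * K + L) * H"
    unfolding F1_def using F P K H L
    by (subst add_mult_distrib_mat[where nr=n and n=p and nc=n]) (auto intro!: eq_matI)
  then show ?case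
    using es' P K L by (intro bexI[of _ "P * K + L"] exI[of _ es']) auto
qed

text \<open>The real linear factors remain a complete factorization over the complex numbers, so
  complexification creates no new roots. This turns the bound on the list \<open>es\<close> into a
  bound on all complex eigenvalues.\<close>

lemma eigenvalue_complexification_of_split:
  assumes A: "A \<in> carrier_mat n n" and cp: "char_poly A = (\<Prod>a\<leftarrow>es. [:- a, 1:])"
    and "eigenvalue (map_mat complex_of_real A) \<mu>"
  shows "\<mu> \<in> complex_of_real ` set es"
proof -
  have root: "poly (map_poly complex_of_real (char_poly A)) \<mu> = 0"
    using assms(3) eigenvalue_root_char_poly[of "map_mat complex_of_real A" n \<mu>] A
    by (simp add: of_real_hom.char_poly_hom[OF A])
  interpret map_poly_hom: map_poly_comm_ring_hom complex_of_real ..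
  have "map_poly complex_of_real (\<Prod>a\<leftarrow>es. [:- a, 1:]) = (\<Prod>a\<leftarrow>es. [:- complex_of_real a, 1:])"
    by (induction es) (auto simp: map_poly_hom.hom_mult simp del: mult_pCons_left)
  with root have "poly (\<Prod>a\<leftarrow>es. [:- complex_of_real a, 1:]) \<mu> = 0"
    by (simp add: cp)
  then show ?thesis by (induction es) auto
qed

lemma eigenvalue_iff_sum:
  fixes A :: "'a::comm_ring_1 mat"
  assumes A: "A \<in> carrier_mat n n"
  shows "eigenvalue A \<mu> \<longleftrightarrow>
    (\<exists>v. (\<exists>i<n. v i \<noteq> 0) \<and> (\<forall>i<n. (\<Sum>j<n. A $$ (i,j) * v j) = \<mu> * v i))"
proof
  assume "eigenvalue A \<mu>"
  then obtain v where v: "v \<in> carrier_vec n" "v \<noteq> 0\<^sub>v n" "A *\<^sub>v v = \<mu> \<cdot>\<^sub>v v"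
    using A by (auto simp: eigenvalue_def eigenvector_def)
  have "\<exists>i<n. v $ i \<noteq> 0" using v(1,2) by (metis carrier_vecD eq_vecI index_zero_vec)
  moreover have "(\<Sum>j<n. A $$ (i,j) * v $ j) = \<mu> * v $ i" if "i < n" for i
    using arg_cong[OF v(3), of "\<lambda>x. x $ i"] that v(1) A
    by (simp add: scalar_prod_def lessThan_atLeast0)
  ultimately show "\<exists>v. (\<exists>i<n. v i \<noteq> 0) \<and> (\<forall>i<n. (\<Sum>j<n. A $$ (i,j) * v j) = \<mu> * v i)"
    by (intro exI[of _ "\<lambda>i. v $ i"]) auto
next
  assume "\<exists>v. (\<exists>i<n. v i \<noteq> 0) \<and> (\<forall>i<n. (\<Sum>j<n. A $$ (i,j) * v j) = \<mu> * v i)"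
  then obtain v i where v: "i < n" "v i \<noteq> 0"
    "\<And>i. i < n \<Longrightarrow> (\<Sum>j<n. A $$ (i,j) * v j) = \<mu> * v i" by blast
  have "vec n v \<noteq> 0\<^sub>v n" using v(1,2) by (metis index_vec index_zero_vec(1))
  moreover have "A *\<^sub>v vec n v = \<mu> \<cdot>\<^sub>v vec n v"
    using A v(3) by (intro eq_vecI) (auto simp: scalar_prod_def lessThan_atLeast0)
  ultimately show "eigenvalue A \<mu>"
    using A unfolding eigenvalue_def eigenvector_def by (intro exI[of _ "vec n v"]) auto
qed

section \<open>The coordinates kept by a local observer\<close>

lemma jordan_apply_diff:
  "jordan_apply lam d (\<lambda>j. f j - g j) j = jordan_apply lam d f j - jordan_apply lam d g j"
  by (cases j) (simp add: jordan_apply_def algebra_simps)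

lemma finite_coords: "finite (coords r g d)"
proof -
  have "coords r g d = Sigma {..<r} (\<lambda>l. Sigma {..<g l} (\<lambda>h. {..<d l h}))"
    by (auto simp: coords_def)
  then show ?thesis by simp
qed

lemma tidx_eq_0_if_G3: "h \<in> G3 g d p Cm i l \<Longrightarrow> tidx p Cm i l h = 0"
  by (auto simp: G3_def tidx_def intro!: Least_equality)

text \<open>Blocks of \<open>G2\<close> and \<open>G3\<close> become one case: on \<open>G3\<close>
  the index \<open>tidx\<close> is 0, so the inequality keeps the whole block.\<close>

lemma Zset_iff:
  "(l,h,k) \<in> Zset r ru g d p Cm i \<longleftrightarrow> (l,h,k) \<in> coords r g d \<and>
     (ru \<le> l \<or> l < ru \<and> h \<in> G2 g d p Cm i l \<union> G3 g d p Cm i l \<and> tidx p Cm i l h \<le> k)"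
  by (auto simp: Zset_def tidx_eq_0_if_G3)

lemma finite_Zset: "finite (Zset r ru g d p Cm i)"
  by (rule finite_subset[OF _ finite_coords[of r g d]]) (auto simp: Zset_def)

text \<open>A tail of a Jordan block is invariant: \<open>jordan_apply\<close> at a kept entry reads
  only kept entries, so the kept coordinates form a subsystem of their own.\<close>

lemma Zset_Suc:
  "(l,h,k) \<in> Zset r ru g d p Cm i \<Longrightarrow> Suc k < d l h \<Longrightarrow> (l,h,Suc k) \<in> Zset r ru g d p Cm i"
  by (auto simp: Zset_iff coords_def)

text \<open>A discarded entry lies in a block of \<open>G1\<close> or before the first nonzero
  output column of a block of \<open>G2\<close>. Hence the measurement of agent \<open>i\<close> is
  a function of its kept coordinates.\<close>

lemma Cm_eq_0_outside_Zset:
  assumes "j \<in> coords r g d" "j \<notin> Zset r ru g d p Cm i" "q < p i"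
  shows "Cm i q j = 0"
proof -
  obtain l h k where j: "j = (l,h,k)" by (cases j)
  have lhk: "l < ru" "h < g l" "k < d l h" "h \<notin> G3 g d p Cm i l"
    "h \<in> G2 g d p Cm i l \<Longrightarrow> k < tidx p Cm i l h"
    using assms by (auto simp: j Zset_def coords_def)
  show ?thesis
  proof (cases "h \<in> G2 g d p Cm i l")
    case True
    then show ?thesis using lhk(5) assms(3) not_less_Least by (fastforce simp: tidx_def j)
  next
    case False
    then show ?thesis using lhk assms(3) by (auto simp: G2_def G3_def j)
  qed
qed

lemma sum_Cm_Zset:
  assumes "q < p i"
  shows "(\<Sum>j\<in>coords r g d. Cm i q j * v j) = (\<Sum>j\<in>Zset r ru g d p Cm i. Cm i q j * v j)"
  using assms Cm_eq_0_outside_Zset[of _ r g d ru p Cm i q]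
  by (intro sum.mono_neutral_right finite_coords) (auto simp: Zset_def)

section \<open>Detectability of the local pairs and the Luenberger gains\<close>

text \<open>The Popov-Belevitch-Hautus test for the pair \<open>(F_{i,d}, H_{i,d})\<close>: an eigenvector of an
  unstable eigenvalue is supported on the first retained entries of the blocks of that eigenvalue,
  whose output columns are independent.\<close>

lemma local_pbh:
  fixes v :: "idx \<Rightarrow> real"
  assumes jordan: "jordan_structure r ru lam g d"
    and indep: "\<forall>l<ru. lin_indep_family (p i) (G2 g d p Cm i l \<union> G3 g d p Cm i l)
               (\<lambda>h q. if h \<in> G3 g d p Cm i l then Cm i q (l,h,0)
                      else Cm i q (l,h,tidx p Cm i l h))"
    and a: "1 \<le> \<bar>a\<bar>"
    and eig: "\<And>j. j \<in> Zset r ru g d p Cm i \<Longrightarrow> jordan_apply lam d v j = a * v j"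
    and out: "\<And>q. q < p i \<Longrightarrow> (\<Sum>j\<in>Zset r ru g d p Cm i. Cm i q j * v j) = 0"
    and j: "j \<in> Zset r ru g d p Cm i"
  shows "v j = 0"
proof -
  let ?Z = "Zset r ru g d p Cm i" and ?t = "tidx p Cm i"
  have step: "(lam l - a) * v (l,h,k) + (if Suc k < d l h then v (l,h,Suc k) else 0) = 0"
    if "(l,h,k) \<in> ?Z" for l h k
    using eig[OF that] by (simp add: jordan_apply_def algebra_simps)
  \<comment> \<open>Backwards from the end of the block: once the next entry is 0, the eigenvector
    equation leaves a nonzero multiple of \<open>v (l,h,k)\<close>.\<close>
  have other: "v (l,h,k) = 0" if "lam l \<noteq> a" "(l,h,k) \<in> ?Z" for l h k
    using that(2)
  proof (induction "d l h - k" arbitrary: k rule: less_induct)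
    case less
    have "Suc k < d l h \<Longrightarrow> v (l,h,Suc k) = 0"
      using less.hyps[of "Suc k"] Zset_Suc[OF less.prems] less.prems
      by (auto simp: Zset_iff coords_def)
    then show ?case using step[OF less.prems] that(1) by (auto split: if_splits)
  qed
  \<comment> \<open>For the eigenvalue \<open>a\<close> itself the diagonal term of
    \<open>step\<close> cancels, so the equation at \<open>k'\<close> says that entry
    \<open>Suc k'\<close> is 0. Only the first kept entry can survive.\<close>
  have later: "v (l,h,k) = 0" if "lam l = a" "(l,h,k) \<in> ?Z" "?t l h \<noteq> k" "l < ru" for l h k
  proof -
    from that obtain k' where k: "k = Suc k'" "?t l h \<le> k'"
      by (cases k) (auto simp: Zset_iff)
    have "(l,h,k') \<in> ?Z" using that k by (auto simp: Zset_iff coords_def)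
    then show ?thesis using step[of l h k'] that k by (auto simp: Zset_iff coords_def)
  qed
  obtain l h k where jj: "j = (l,h,k)" by (cases j)
  have l: "l < r" using j by (simp add: jj Zset_iff coords_def)
  show ?thesis
  proof (cases "lam l = a")
    case True
    then have lu: "l < ru" using jordan a l by (auto simp: jordan_structure_def)
    let ?H = "G2 g d p Cm i l \<union> G3 g d p Cm i l"
    have Hg: "h < g l" if "h \<in> ?H" for h using that by (auto simp: G2_def G3_def)
    \<comment> \<open>The \<open>LEAST\<close> in \<open>tidx\<close> ranges over all naturals; a
      nonzero column inside the block brings it below \<open>d l h\<close>.\<close>
    have td: "?t l h < d l h" if hH: "h \<in> ?H" for h
    proof (cases "h \<in> G3 g d p Cm i l")
      case True
      then show ?thesis using Hg[OF hH] l jordan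
        by (auto simp: tidx_eq_0_if_G3 jordan_structure_def Suc_le_eq)
    next
      case False
      then obtain q k where "q < p i" "k < d l h" "Cm i q (l,h,k) \<noteq> 0"
        using hH by (auto simp: G2_def)
      then have "?t l h \<le> k" unfolding tidx_def by (intro Least_le) auto
      then show ?thesis using \<open>k < d l h\<close> by simp
    qed
    let ?S = "(\<lambda>h. (l,h,?t l h)) ` ?H"
    have "?S \<subseteq> ?Z" using td Hg l lu by (auto simp: Zset_iff coords_def)
    moreover have "v j = 0" if "j \<in> ?Z - ?S" for j
    proof -
      obtain l' h' k' where j: "j = (l',h',k')" by (cases j)
      show ?thesis
      proof (cases "lam l' = a")
        case eq: True
        \<comment> \<open>The \<open>lam\<close> are distinct, so all surviving entries belong to
          the single index \<open>l\<close> and (A2) for this \<open>l\<close> applies.\<close>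
        then have "l' = l" using that True jordan l
          by (auto simp: j jordan_structure_def Zset_iff coords_def inj_on_def)
        then show ?thesis using later[OF eq] that lu
          by (fastforce simp: j Zset_iff coords_def)
      next
        case False
        then show ?thesis using other that by (simp add: j)
      qed
    qed
    ultimately have red: "(\<Sum>j\<in>?Z. Cm i q j * v j) = (\<Sum>j\<in>?S. Cm i q j * v j)" for q
      by (intro sum.mono_neutral_right finite_Zset) auto
    have "(\<Sum>h\<in>?H. v (l,h,?t l h) *
        (if h \<in> G3 g d p Cm i l then Cm i q (l,h,0) else Cm i q (l,h,?t l h))) = 0"
      if "q < p i" for q
    proof -
      have "(\<Sum>h\<in>?H. v (l,h,?t l h) *
          (if h \<in> G3 g d p Cm i l then Cm i q (l,h,0) else Cm i q (l,h,?t l h))) =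
          (\<Sum>j\<in>?S. Cm i q j * v j)"
        by (subst sum.reindex) (auto simp: inj_on_def tidx_eq_0_if_G3 mult.commute intro!: sum.cong)
      then show ?thesis using red out[OF that] by simp
    qed
    then have zero: "\<forall>h\<in>?H. v (l,h,?t l h) = 0"
      using indep[unfolded lin_indep_family_def, rule_format, OF lu, of "\<lambda>h. v (l,h,?t l h)"] by blast
    show ?thesis
    proof (cases "?t l h = k")
      case eq: True
      then show ?thesis using zero j lu by (auto simp: jj Zset_iff)
    next
      case False
      then show ?thesis using later True j lu by (simp add: jj)
    qed
  qed (use other j jj in auto)
qed

text \<open>Stated for error trajectories alone, because plant state and input cancel there. An
  enumeration of \<open>Z\<close> transfers the problem to matrices, where \<open>local_pbh\<close>
  is the hypothesis that \<open>stabilizing_output_injection\<close> asks for.\<close>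

lemma luenberger_gain_exists:
  assumes jordan: "jordan_structure r ru lam g d"
    and indep: "\<forall>l<ru. lin_indep_family (p i) (G2 g d p Cm i l \<union> G3 g d p Cm i l)
               (\<lambda>h q. if h \<in> G3 g d p Cm i l then Cm i q (l,h,0)
                      else Cm i q (l,h,tidx p Cm i l h))"
  defines "Z \<equiv> Zset r ru g d p Cm i"
  shows "\<exists>Lg :: idx \<Rightarrow> nat \<Rightarrow> real. \<forall>e.
    (\<forall>t. \<forall>j\<in>Z. e (Suc t) j = jordan_apply lam d (e t) j
        - (\<Sum>q<p i. Lg j q * (\<Sum>j'\<in>Z. Cm i q j' * e t j'))) \<longrightarrow>
    (\<forall>j\<in>Z. (\<lambda>t. e t j) \<longlonglongrightarrow> 0)"
proof -
  have finZ: "finite Z" by (simp add: Z_def finite_Zset)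
  obtain ys where ys: "set ys = Z" "distinct ys" using finite_distinct_list[OF finZ] by blast
  \<comment> \<open>Listing the coordinates by their position inside the block makes the matrix triangular.\<close>
  define zs where "zs = sort_key (\<lambda>j. snd (snd j)) ys"
  have zs: "set zs = Z" "distinct zs" "sorted (map (\<lambda>j. snd (snd j)) zs)"
    using ys by (auto simp: zs_def)
  define n where "n = length zs"
  have bij: "bij_betw ((!) zs) {..<n} Z"
    using bij_betw_nth[OF zs(2), of "{..<n}" Z] zs(1) by (simp add: n_def)
  define ix where "ix = the_inv_into {..<n} ((!) zs)"
  have ix: "ix (zs ! b) = b" if "b < n" for b
    using the_inv_into_f_f[of "(!) zs" "{..<n}" b] bij that by (auto simp: ix_def bij_betw_def)
  have nthZ: "zs ! b \<in> Z" if "b < n" for b using that zs(1) by (auto simp: n_def)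
  have exnth: "\<exists>b<n. j = zs ! b" if "j \<in> Z" for j
    using that zs(1) by (auto simp: n_def in_set_conv_nth)
  have sumZ: "(\<Sum>j\<in>Z. f j) = (\<Sum>b<n. f (zs ! b))" for f :: "idx \<Rightarrow> real"
    using sum.reindex_bij_betw[OF bij, of f] by simp
  \<comment> \<open>The matrix of \<open>jordan_apply\<close>. The condition
    \<open>Suc k < d l h\<close> is supplied by membership in \<open>Z\<close>, over which the sums
    with \<open>J\<close> run.\<close>
  define J :: "idx \<Rightarrow> idx \<Rightarrow> real" where
    "J = (\<lambda>(l,h,k) j'. (if j' = (l,h,k) then lam l else 0) + (if j' = (l,h,Suc k) then 1 else 0))"
  have J: "jordan_apply lam d v j = (\<Sum>j'\<in>Z. J j j' * v j')" if "j \<in> Z" for v j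
  proof -
    obtain l h k where j: "j = (l,h,k)" by (cases j)
    have "(l,h,Suc k) \<in> Z \<longleftrightarrow> Suc k < d l h"
      using that Zset_Suc[of l h k] by (auto simp: j Z_def Zset_iff coords_def)
    moreover have "(\<Sum>j'\<in>Z. J j j' * v j') =
        (\<Sum>j'\<in>Z. if j' = j then lam l * v j else 0) +
        (\<Sum>j'\<in>Z. if j' = (l,h,Suc k) then v (l,h,Suc k) else 0)"
      unfolding sum.distrib[symmetric] by (intro sum.cong) (auto simp: J_def j)
    ultimately show ?thesis using finZ that by (simp add: j jordan_apply_def)
  qed
  define F where "F = mat n n (\<lambda>(a,b). J (zs ! a) (zs ! b))"
  define H where "H = mat (p i) n (\<lambda>(q,b). Cm i q (zs ! b))"
  have F: "F \<in> carrier_mat n n" and H: "H \<in> carrier_mat (p i) n" by (auto simp: F_def H_def)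
  have "upper_triangular F"
    unfolding upper_triangular_def
  proof (intro allI impI)
    fix a b assume a: "a < dim_row F" and b: "b < a"
    then have ab: "a < n" "b < n" by (auto simp: F_def)
    have "zs ! a \<noteq> zs ! b" using zs(2) ab b by (simp add: nth_eq_iff_index_eq n_def)
    moreover have "snd (snd (zs ! b)) \<le> snd (snd (zs ! a))"
      using sorted_nth_mono[OF zs(3), of b a] ab b by (simp add: n_def)
    ultimately show "F $$ (a,b) = 0"
      using ab by (cases "zs ! a") (auto simp: F_def J_def)
  qed
  note cpF = char_poly_upper_triangular[OF F this]
  have "\<exists>L \<in> carrier_mat n (p i). \<exists>es'. char_poly (F - L * H) = (\<Prod>a\<leftarrow>es'. [:- a, 1:]) \<and>
           (\<forall>a\<in>set es'. \<bar>a\<bar> < 1)"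
  proof (rule stabilizing_output_injection[OF F H cpF])
    fix a v
    assume a: "1 \<le> \<bar>a\<bar>" and v: "v \<in> carrier_vec n" and Fv: "F *\<^sub>v v = a \<cdot>\<^sub>v v"
      and Hv: "H *\<^sub>v v = 0\<^sub>v (p i)"
    have eig: "jordan_apply lam d (\<lambda>j. v $ ix j) j = a * v $ ix j" if j: "j \<in> Z" for j
    proof -
      obtain b where b: "b < n" "j = zs ! b" using exnth[OF j] by blast
      have "jordan_apply lam d (\<lambda>j. v $ ix j) j = (\<Sum>c<n. J (zs ! b) (zs ! c) * v $ c)"
        unfolding J[OF j] sumZ by (intro sum.cong) (auto simp: ix b(2))
      also have "\<dots> = (F *\<^sub>v v) $ b"
        using b v by (simp add: F_def scalar_prod_def lessThan_atLeast0)
      finally show ?thesis using b v Fv by (simp add: ix)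
    qed
    have out: "(\<Sum>j\<in>Z. Cm i q j * v $ ix j) = 0" if "q < p i" for q
    proof -
      have "(\<Sum>j\<in>Z. Cm i q j * v $ ix j) = (\<Sum>c<n. Cm i q (zs ! c) * v $ c)"
        by (simp add: sumZ ix)
      also have "\<dots> = (H *\<^sub>v v) $ q"
        using that v by (simp add: H_def scalar_prod_def lessThan_atLeast0)
      finally show ?thesis using that by (simp add: Hv)
    qed
    have "v $ b = 0" if "b < n" for b
      using local_pbh[OF jordan indep a, of "\<lambda>j. v $ ix j" "zs ! b"] eig out nthZ[OF that] that
      by (simp add: Z_def[symmetric] ix)
    then show "v = 0\<^sub>v n" using v by (intro eq_vecI) auto
  qed
  then obtain L es where L: "L \<in> carrier_mat n (p i)"
    and es: "char_poly (F - L * H) = (\<Prod>a\<leftarrow>es. [:- a, 1:])" "\<forall>a\<in>set es. \<bar>a\<bar> < 1" by blast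
  define M where "M = F - L * H"
  have M: "M \<in> carrier_mat n n" unfolding M_def by (rule minus_carrier_mat[OF mult_carrier_mat[OF L H]])
  have Mentry: "M $$ (a,b) = J (zs ! a) (zs ! b) - (\<Sum>q<p i. L $$ (a,q) * Cm i q (zs ! b))"
    if "a < n" "b < n" for a b
    using that L by (simp add: M_def F_def H_def scalar_prod_def lessThan_atLeast0)
  \<comment> \<open>The characteristic polynomial of \<open>M\<close> splits over the reals, so its
    complex eigenvalues are among the small real numbers in \<open>es\<close>.\<close>
  have Meig: "cmod \<mu> < 1" if "eigenvalue (map_mat complex_of_real M) \<mu>" for \<mu>
    using eigenvalue_complexification_of_split[OF M _ that, of es] es by (auto simp: M_def)
  show ?thesis
  proof (intro exI[of _ "\<lambda>j q. L $$ (ix j, q)"] allI impI ballI)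
    fix e :: "nat \<Rightarrow> idx \<Rightarrow> real" and j
    assume e: "\<forall>t. \<forall>j\<in>Z. e (Suc t) j = jordan_apply lam d (e t) j
        - (\<Sum>q<p i. L $$ (ix j, q) * (\<Sum>j'\<in>Z. Cm i q j' * e t j'))" and j: "j \<in> Z"
    obtain b where b: "b < n" "j = zs ! b" using exnth[OF j] by blast
    have rec: "e (Suc t) (zs ! a) = (\<Sum>c<n. M $$ (a,c) * e t (zs ! c)) + 0" if "a < n" for a t
    proof -
      have "e (Suc t) (zs ! a) = (\<Sum>c<n. J (zs ! a) (zs ! c) * e t (zs ! c))
        - (\<Sum>q<p i. \<Sum>c<n. L $$ (a,q) * (Cm i q (zs ! c) * e t (zs ! c)))"
        using e nthZ[OF that] that by (simp add: J sumZ ix sum_distrib_left)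
      also have "\<dots> = (\<Sum>c<n. M $$ (a,c) * e t (zs ! c))"
        by (subst sum.swap) (simp add: Mentry that sum_subtractf left_diff_distrib sum_distrib_right mult.assoc)
      finally show ?thesis by simp
    qed
    show "(\<lambda>t. e t j) \<longlonglongrightarrow> 0"
      unfolding b(2)
      by (rule perturbed_linear_recursion_tendsto_zero[where e="\<lambda>t a. e t (zs ! a)" and b="\<lambda>_ _. 0",
            OF M Meig rec _ b(1)]) auto
  qed
qed

section \<open>The Laplacian and the consensus errors\<close>

text \<open>Links the differences in the observer equations to the matrix in the spectral condition.
  The general value type serves real errors as well as complex eigenvectors.\<close>

lemma laplacian_sum:
  fixes f :: "nat \<Rightarrow> 'a::real_algebra_1"
  assumes "i < N"
  shows "(\<Sum>a<N. of_real (laplacian N Adj i a) * f a) = (\<Sum>a<N. of_real (Adj i a) * (f i - f a))"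
proof -
  have "(\<Sum>a<N. of_real (laplacian N Adj i a) * f a) =
      (\<Sum>a<N. (if a = i then of_real (\<Sum>b<N. Adj i b) * f i else 0) - of_real (Adj i a) * f a)"
    by (intro sum.cong) (auto simp: laplacian_def algebra_simps)
  also have "\<dots> = (\<Sum>a<N. of_real (Adj i a) * (f i - f a))"
    using assms by (simp add: sum_subtractf right_diff_distrib sum_distrib_right)
  finally show ?thesis .
qed

lemma reduced_laplacian_sum:
  fixes f :: "nat \<Rightarrow> 'a::real_algebra_1" and N :: nat and V :: "nat set"
  defines "s \<equiv> sorted_list_of_set ({..<N} - V)"
  assumes "a < length s"
  shows "(\<Sum>b<length s. of_real (reduced_laplacian N Adj V $$ (a,b)) * f (s ! b)) =
    (\<Sum>j\<in>{..<N} - V. of_real (laplacian N Adj (s ! a) j) * f j)"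
proof -
  have "bij_betw ((!) s) {..<length s} ({..<N} - V)"
    by (rule bij_betw_nth) (auto simp: s_def)
  then have "(\<Sum>j\<in>{..<N} - V. of_real (laplacian N Adj (s ! a) j) * f j) =
      (\<Sum>b<length s. of_real (laplacian N Adj (s ! a) (s ! b)) * f (s ! b))"
    by (rule sum.reindex_bij_betw[symmetric])
  also have "\<dots> = (\<Sum>b<length s. of_real (reduced_laplacian N Adj V $$ (a,b)) * f (s ! b))"
    using assms(2) by (intro sum.cong) (auto simp: reduced_laplacian_def s_def Let_def)
  finally show ?thesis ..
qed

text \<open>For nonzero \<open>k\<close> the matrices \<open>A\<close> and
  \<open>c * (I - k * A)\<close> have the same eigenvectors, with eigenvalues related by
  \<open>\<nu> = c * (1 - k * \<mu>)\<close>.\<close>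

lemma eigenvalue_scaled_identity_minus:
  fixes A :: "real mat" and c k :: real
  assumes A: "A \<in> carrier_mat n n"
    and c: "1 \<le> \<bar>c\<bar>"
    and spec: "\<forall>\<mu>\<in>spec A. cmod (1 - complex_of_real k * \<mu>) < 1 / \<bar>c\<bar>"
    and ev: "eigenvalue (map_mat complex_of_real
               (mat n n (\<lambda>(a,b). c * ((if a = b then 1 else 0) - k * A $$ (a,b))))) \<nu>"
  shows "cmod \<nu> < 1"
proof -
  have A': "map_mat complex_of_real A \<in> carrier_mat n n" using A by simp
  from ev obtain v i where i: "i < n" "v i \<noteq> 0"
    and v: "\<And>a. a < n \<Longrightarrow>
      (\<Sum>b<n. complex_of_real (c * ((if a = b then 1 else 0) - k * A $$ (a,b))) * v b) = \<nu> * v a"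
    by (subst (asm) eigenvalue_iff_sum[where n=n]) auto
  have sum: "complex_of_real c * (v a - complex_of_real k * (\<Sum>b<n. complex_of_real (A $$ (a,b)) * v b)) = \<nu> * v a"
    if "a < n" for a
  proof -
    have "(\<Sum>b<n. complex_of_real (c * ((if a = b then 1 else 0) - k * A $$ (a,b))) * v b) =
      (\<Sum>b<n. complex_of_real c * ((if b = a then v a else 0)
          - complex_of_real k * (complex_of_real (A $$ (a,b)) * v b)))"
      by (intro sum.cong) (auto simp: algebra_simps)
    also have "\<dots> = complex_of_real c * (v a - complex_of_real k * (\<Sum>b<n. complex_of_real (A $$ (a,b)) * v b))"
      using that by (simp add: sum_distrib_left[symmetric] sum_subtractf)
    finally show ?thesis using v[OF that] by simp
  qed
  \<comment> \<open>As \<open>n > 0\<close>, the complex spectrum is nonempty, and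
    \<open>k = 0\<close> would give \<open>1 < 1 / \<bar>c\<bar>\<close> although
    \<open>1 \<le> \<bar>c\<bar>\<close>.\<close>
  have "k \<noteq> 0"
  proof
    assume "k = 0"
    obtain as where "char_poly (map_mat complex_of_real A) = (\<Prod>a\<leftarrow>as. [:- a, 1:])" "length as = n"
      using char_poly_factorized[OF A'] by blast
    then have "poly (char_poly (map_mat complex_of_real A)) (hd as) = 0"
      using i linear_poly_root[of "hd as" as] by (cases as) auto
    then have "hd as \<in> spec A" using eigenvalue_root_char_poly[OF A'] by (simp add: spec_def)
    then have "cmod (1 - complex_of_real k * hd as) < 1 / \<bar>c\<bar>" using spec by blast
    then show False using c \<open>k = 0\<close> by (simp add: field_simps)
  qed
  have c0: "c \<noteq> 0" using c by auto
  define \<mu> where "\<mu> = (1 - \<nu> / complex_of_real c) / complex_of_real k"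
  have \<nu>: "\<nu> = complex_of_real c * (1 - complex_of_real k * \<mu>)"
    using c0 \<open>k \<noteq> 0\<close> by (simp add: \<mu>_def field_simps)
  have "(\<Sum>b<n. complex_of_real (A $$ (a,b)) * v b) = \<mu> * v a" if "a < n" for a
  proof -
    have "v a - complex_of_real k * (\<Sum>b<n. complex_of_real (A $$ (a,b)) * v b)
        = (1 - complex_of_real k * \<mu>) * v a"
      using sum[OF that] c0 unfolding \<nu> mult.assoc by simp
    then have "complex_of_real k * (\<Sum>b<n. complex_of_real (A $$ (a,b)) * v b) = complex_of_real k * (\<mu> * v a)"
      by (simp add: left_diff_distrib mult.assoc)
    then show ?thesis using \<open>k \<noteq> 0\<close> by simp
  qed
  then have "\<mu> \<in> spec A"
    unfolding spec_def mem_Collect_eq eigenvalue_iff_sum[OF A'] using i A by (intro exI[of _ v]) auto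
  then have "\<bar>c\<bar> * cmod (1 - complex_of_real k * \<mu>) < 1"
    using spec c0 by (auto simp: field_simps)
  then show ?thesis by (simp add: \<nu> norm_mult)
qed

text \<open>Induction from the last entry of the Jordan chain to the first. For each entry the
  agents outside \<open>V\<close> follow a stable recursion with matrix
  \<open>c * (I - k * R)\<close>, driven by the agents in \<open>V\<close> and by the next entry.
  \<open>D\<close> is the error after coupling; it occurs in both terms of \<open>rec\<close>
  because the Jordan block also multiplies the coupling.\<close>

lemma consensus_error_tendsto_zero:
  fixes E :: "nat \<Rightarrow> nat \<Rightarrow> nat \<Rightarrow> real" and c k :: real
  assumes c: "1 \<le> \<bar>c\<bar>"
    and spec: "\<forall>\<mu>\<in>spec (reduced_laplacian N Adj V). cmod (1 - complex_of_real k * \<mu>) < 1 / \<bar>c\<bar>"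
    and V: "\<And>i \<kappa>. i < N \<Longrightarrow> i \<in> V \<Longrightarrow> \<kappa> < \<delta> \<Longrightarrow> (\<lambda>t. E i t \<kappa>) \<longlonglongrightarrow> 0"
    and D: "\<And>i t \<kappa>. D i t \<kappa> = E i t \<kappa> - k * (\<Sum>a<N. Adj i a * (E i t \<kappa> - E a t \<kappa>))"
    and rec: "\<And>i t \<kappa>. i < N \<Longrightarrow> i \<notin> V \<Longrightarrow> \<kappa> < \<delta> \<Longrightarrow>
       E i (Suc t) \<kappa> = c * D i t \<kappa> + (if Suc \<kappa> < \<delta> then D i t (Suc \<kappa>) else 0)"
    and "i < N" "\<kappa> < \<delta>"
  shows "(\<lambda>t. E i t \<kappa>) \<longlonglongrightarrow> 0"
  using \<open>i < N\<close> \<open>\<kappa> < \<delta>\<close>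
proof (induction "\<delta> - \<kappa>" arbitrary: i \<kappa> rule: less_induct)
  case less
  show ?case
  proof (cases "i \<in> V")
    case True
    then show ?thesis using V less.prems by blast
  next
    case False
    define s where "s = sorted_list_of_set ({..<N} - V)"
    define n where "n = length s"
    have s: "set s = {..<N} - V" by (simp add: s_def)
    define R where "R = reduced_laplacian N Adj V"
    have R: "R \<in> carrier_mat n n"
      by (simp add: R_def reduced_laplacian_def Let_def n_def s_def)
    define M where "M = mat n n (\<lambda>(a,b). c * ((if a = b then 1 else 0) - k * R $$ (a,b)))"
    have M: "M \<in> carrier_mat n n" by (simp add: M_def)
    have Meig: "cmod \<nu> < 1" if "eigenvalue (map_mat complex_of_real M) \<nu>" for \<nu>
      using eigenvalue_scaled_identity_minus[OF R c] spec that by (simp add: M_def R_def)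
    \<comment> \<open>The two vanishing inputs: coupling from agents in \<open>V\<close>, and the
      next entry of the chain, which is absent at the end of the block.\<close>
    define b where "b t a = c * k * (\<Sum>j\<in>{..<N} \<inter> V. Adj (s ! a) j * E j t \<kappa>)
      + (if Suc \<kappa> < \<delta> then D (s ! a) t (Suc \<kappa>) else 0)" for t a
    have sa: "s ! a < N" "s ! a \<notin> V" if "a < n" for a
      using nth_mem[of a s] that by (auto simp: n_def s)
    have bM: "E (s ! a) (Suc t) \<kappa> = (\<Sum>j<n. M $$ (a,j) * E (s ! j) t \<kappa>) + b t a"
      if a: "a < n" for a t
    proof -
      let ?i = "s ! a"
      have "(\<Sum>j<n. M $$ (a,j) * E (s ! j) t \<kappa>) =
          (\<Sum>j<n. c * ((if j = a then E ?i t \<kappa> else 0) - k * (R $$ (a,j) * E (s ! j) t \<kappa>)))"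
        using a by (intro sum.cong) (auto simp: M_def algebra_simps)
      also have "\<dots> = c * (E ?i t \<kappa> - k * (\<Sum>j<n. R $$ (a,j) * E (s ! j) t \<kappa>))"
        using a by (simp add: sum_distrib_left[symmetric] sum_subtractf)
      also have "(\<Sum>j<n. R $$ (a,j) * E (s ! j) t \<kappa>) =
          (\<Sum>j\<in>{..<N} - V. laplacian N Adj ?i j * E j t \<kappa>)"
        using reduced_laplacian_sum[of a N V Adj "\<lambda>j. E j t \<kappa>"] a
        by (simp add: R_def n_def s_def)
      finally have 1: "(\<Sum>j<n. M $$ (a,j) * E (s ! j) t \<kappa>) =
          c * (E ?i t \<kappa> - k * (\<Sum>j\<in>{..<N} - V. laplacian N Adj ?i j * E j t \<kappa>))" .
      have "(\<Sum>j<N. Adj ?i j * (E ?i t \<kappa> - E j t \<kappa>)) = (\<Sum>j<N. laplacian N Adj ?i j * E j t \<kappa>)"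
        using laplacian_sum[OF sa(1)[OF a], of Adj "\<lambda>j. E j t \<kappa>"] by simp
      also have "\<dots> = (\<Sum>j\<in>{..<N} - V. laplacian N Adj ?i j * E j t \<kappa>)
          + (\<Sum>j\<in>{..<N} \<inter> V. laplacian N Adj ?i j * E j t \<kappa>)"
        by (subst sum.union_disjoint[symmetric]) (auto intro!: sum.cong)
      \<comment> \<open>Agent \<open>?i\<close> is outside \<open>V\<close>, so only off-diagonal
        entries \<open>- Adj ?i j\<close> occur here.\<close>
      also have "(\<Sum>j\<in>{..<N} \<inter> V. laplacian N Adj ?i j * E j t \<kappa>) =
          - (\<Sum>j\<in>{..<N} \<inter> V. Adj ?i j * E j t \<kappa>)"
        using sa(2)[OF a] unfolding sum_negf[symmetric]
        by (intro sum.cong) (auto simp: laplacian_def)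
      finally have 2: "(\<Sum>j<N. Adj ?i j * (E ?i t \<kappa> - E j t \<kappa>)) =
          (\<Sum>j\<in>{..<N} - V. laplacian N Adj ?i j * E j t \<kappa>)
          - (\<Sum>j\<in>{..<N} \<inter> V. Adj ?i j * E j t \<kappa>)" by simp
      show ?thesis
        unfolding rec[OF sa[OF a] less.prems(2)] D[of ?i t \<kappa>] 1 2 b_def
        by (simp add: right_diff_distrib)
    qed
    have lim: "(\<lambda>t. b t a) \<longlonglongrightarrow> 0" if a: "a < n" for a
    proof -
      have "(\<lambda>t. c * k * (\<Sum>j\<in>{..<N} \<inter> V. Adj (s ! a) j * E j t \<kappa>)) \<longlonglongrightarrow> 0"
        using V less.prems(2) by (intro tendsto_mult_right_zero tendsto_null_sum) auto
      moreover have "(\<lambda>t. if Suc \<kappa> < \<delta> then D (s ! a) t (Suc \<kappa>) else 0) \<longlonglongrightarrow> 0"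
      proof (cases "Suc \<kappa> < \<delta>")
        case True
        have "(\<lambda>t. E j t (Suc \<kappa>)) \<longlonglongrightarrow> 0" if "j < N" for j
          using less.hyps[of "Suc \<kappa>" j] that True by simp
        then have "(\<lambda>t. D (s ! a) t (Suc \<kappa>)) \<longlonglongrightarrow> 0 - k * (\<Sum>j<N. Adj (s ! a) j * (0 - 0))"
          unfolding D using sa(1)[OF a] by (intro tendsto_intros) auto
        then show ?thesis using True by simp
      qed simp
      ultimately show ?thesis unfolding b_def by (rule tendsto_add_zero)
    qed
    have "i \<in> set s" using False less.prems(1) s by simp
    then obtain a where a: "a < n" "i = s ! a" by (auto simp: in_set_conv_nth n_def)
    show ?thesis
      unfolding a(2)
      by (rule perturbed_linear_recursion_tendsto_zero[where e="\<lambda>t a. E (s ! a) t \<kappa>" and b=b,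
            OF M Meig bM lim a(1)])
  qed
qed

section \<open>Necessity of the spectral condition\<close>

text \<open>Errors confined to the first entry of a single block \<open>(l,h)\<close> form an invariant subspace
  of the closed loop, on which the dynamics is \<open>\<lambda>\<^sub>l (I - k \<L>)\<close>.\<close>

lemma closed_loop_on_leading_entry:
  fixes f :: "nat \<Rightarrow> nat \<Rightarrow> real"
  assumes conv: "\<forall>x u zh w. closed_loop r ru lam g d m Bm N p Cm Adj Lg kg x u zh w \<longrightarrow>
              (\<forall>i<N. \<forall>j\<in>coords r g d.
                 (\<lambda>t. x t j - est ru g d p Cm zh w i t j) \<longlonglongrightarrow> 0)"
    and jordan: "jordan_structure r ru lam g d"
    and l: "l < ru" and h: "h < g l"
    and V: "\<And>t i. i \<in> V3 g d p Cm N l h \<Longrightarrow> f t i = 0"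
    and rec: "\<And>t i. i < N \<Longrightarrow> i \<notin> V3 g d p Cm N l h \<Longrightarrow>
       f (Suc t) i = lam l * (f t i - kg l h * (\<Sum>a<N. Adj i a * (f t i - f t a)))"
    and i: "i < N" "i \<notin> V3 g d p Cm N l h"
  shows "(\<lambda>t. f t i) \<longlonglongrightarrow> 0"
proof -
  \<comment> \<open>Plant, input and local observers stay at 0, so the estimation error is
    \<open>- f\<close>. For agents in \<open>V3\<close> the estimate is the zero local state, in
    agreement with \<open>V\<close>.\<close>
  define w where "w i t j = (if j = (l,h,0) then f t i else 0)" for i t and j :: idx
  define zh where "zh i t j = (0::real)" for i t :: nat and j :: idx
  have est: "est ru g d p Cm zh w a t j = w a t j" if "a < N" for a t j
    using V[of a t] that l by (cases j) (auto simp: est_def w_def zh_def V3_def)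
  have d0: "0 < d l h" using jordan l h by (auto simp: jordan_structure_def Suc_le_eq)
  have "closed_loop r ru lam g d m Bm N p Cm Adj Lg kg (\<lambda>_ _. 0) (\<lambda>_ _. 0) zh w"
    unfolding closed_loop_def
  proof (intro conjI allI ballI impI)
    fix i t l' h' k'
    assume i: "i < N" and l': "l' < ru" "h' < g l'" "h' \<notin> G3 g d p Cm i l'" "k' < d l' h'"
    have "w i (Suc t) (l',h',k') = jordan_apply lam d (w i t) (l',h',k')
        + kg l' h' * jordan_apply lam d (\<lambda>j'. \<Sum>a<N. Adj i a * (w a t j' - w i t j')) (l',h',k')"
    proof (cases "(l',h',k') = (l,h,0)")
      case True
      then have "i \<notin> V3 g d p Cm N l h" using l' by (simp add: V3_def)
      moreover have "(\<Sum>a<N. Adj i a * (f t i - f t a)) = - (\<Sum>a<N. Adj i a * (f t a - f t i))"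
        by (simp add: sum_negf[symmetric] algebra_simps)
      ultimately show ?thesis using True rec[OF i, of t]
        by (simp add: w_def jordan_apply_def algebra_simps)
    next
      \<comment> \<open>Both sides are 0: the superdiagonal term reads an entry with index
        \<open>Suc k'\<close>, never the leading entry.\<close>
      case False
      then show ?thesis by (auto simp: w_def jordan_apply_def)
    qed
    then show "w i (Suc t) (l',h',k') = jordan_apply lam d (w i t) (l',h',k')
        + (\<Sum>c<m. Bm (l',h',k') c * 0)
        + kg l' h' * jordan_apply lam d
            (\<lambda>j'. \<Sum>a<N. Adj i a * (est ru g d p Cm zh w a t j' - w i t j')) (l',h',k')"
      by (simp add: est)
  qed (auto simp: zh_def jordan_apply_def)
  moreover have "(l,h,0) \<in> coords r g d"
    using l h d0 jordan by (auto simp: coords_def jordan_structure_def)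
  ultimately have "(\<lambda>t. 0 - est ru g d p Cm zh w i t (l,h,0)) \<longlonglongrightarrow> 0"
    using conv i(1) by blast
  then have "(\<lambda>t. - f t i) \<longlonglongrightarrow> 0" by (simp add: est[OF i(1)] w_def)
  from tendsto_minus[OF this] show ?thesis by simp
qed

text \<open>An eigenvector for \<open>\<mu>\<close>, extended by 0 to \<open>V3\<close>, yields
  error trajectories \<open>\<nu> ^ t * z\<close> with
  \<open>\<nu> = lam l * (1 - kg l h * \<mu>)\<close>. Their convergence to 0 forces
  \<open>cmod \<nu> < 1\<close>.\<close>

lemma spectral_condition_if_observer:
  assumes conv: "\<forall>x u zh w. closed_loop r ru lam g d m Bm N p Cm Adj Lg kg x u zh w \<longrightarrow>
              (\<forall>i<N. \<forall>j\<in>coords r g d.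
                 (\<lambda>t. x t j - est ru g d p Cm zh w i t j) \<longlonglongrightarrow> 0)"
    and jordan: "jordan_structure r ru lam g d"
    and l: "l < ru" and h: "h < g l"
    and \<mu>: "\<mu> \<in> spec (reduced_laplacian N Adj (V3 g d p Cm N l h))"
  shows "cmod (1 - complex_of_real (kg l h) * \<mu>) < 1 / \<bar>lam l\<bar>"
proof -
  define V where "V = V3 g d p Cm N l h"
  define s where "s = sorted_list_of_set ({..<N} - V)"
  define n where "n = length s"
  have s: "set s = {..<N} - V" "distinct s" by (simp_all add: s_def)
  define R where "R = reduced_laplacian N Adj V"
  have R: "R \<in> carrier_mat n n"
    by (simp add: R_def reduced_laplacian_def Let_def n_def s_def)
  have "eigenvalue (map_mat complex_of_real R) \<mu>" using \<mu> by (simp add: spec_def R_def V_def)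
  then obtain v b0 where b0: "b0 < n" "v b0 \<noteq> 0"
    and v: "\<And>a. a < n \<Longrightarrow> (\<Sum>b<n. complex_of_real (R $$ (a,b)) * v b) = \<mu> * v a"
    using R by (subst (asm) eigenvalue_iff_sum[where n=n]) auto
  define z where "z i = (if i \<in> set s then v (the_inv_into {..<n} ((!) s) i) else 0)" for i
  have "inj_on ((!) s) {..<n}" using s(2) by (auto simp: n_def inj_on_nth)
  then have z_nth: "z (s ! b) = v b" if "b < n" for b
    using that by (simp add: z_def n_def the_inv_into_f_f)
  have zV: "z i = 0" if "i \<in> V" for i using that by (simp add: z_def s)
  have zeig: "(\<Sum>a<N. complex_of_real (Adj i a) * (z i - z a)) = \<mu> * z i" if "i < N" "i \<notin> V" for i
  proof -
    have "i \<in> set s" using that s(1) by simp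
    then obtain a where a: "a < n" "i = s ! a" by (auto simp: in_set_conv_nth n_def)
    have "(\<Sum>a<N. complex_of_real (Adj i a) * (z i - z a)) =
        (\<Sum>j<N. complex_of_real (laplacian N Adj i j) * z j)"
      by (rule laplacian_sum[OF that(1), symmetric])
    also have "\<dots> = (\<Sum>j\<in>{..<N} - V. complex_of_real (laplacian N Adj i j) * z j)"
      \<comment> \<open>The zero extension removes the columns of \<open>V\<close>, leaving the
        reduced matrix.\<close>
      by (intro sum.mono_neutral_right) (auto simp: zV)
    also have "\<dots> = (\<Sum>b<n. complex_of_real (R $$ (a,b)) * z (s ! b))"
      using reduced_laplacian_sum[of a N V Adj z] a by (simp add: R_def n_def s_def)
    also have "\<dots> = \<mu> * z i" using v[OF a(1)] a by (simp add: z_nth)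
    finally show ?thesis .
  qed
  define \<nu> where "\<nu> = complex_of_real (lam l) * (1 - complex_of_real (kg l h) * \<mu>)"
  \<comment> \<open>\<open>\<phi>\<close> stands for \<open>Re\<close> and \<open>Im\<close>. The
    recursion has real coefficients, so both parts are admissible real error trajectories.\<close>
  have lim: "(\<lambda>t. \<phi> (\<nu> ^ t * z i)) \<longlonglongrightarrow> 0"
    if \<phi>: "bounded_linear \<phi>" and i: "i < N" "i \<notin> V" for i and \<phi> :: "complex \<Rightarrow> real"
  proof -
    interpret bounded_linear \<phi> by (rule \<phi>)
    have of_real: "\<phi> (complex_of_real a * y) = a * \<phi> y" for a y
      using scale[of a y] by (simp add: scaleR_conv_of_real)
    have "\<phi> (\<nu> ^ Suc t * z i) = lam l * (\<phi> (\<nu> ^ t * z i)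
        - kg l h * (\<Sum>a<N. Adj i a * (\<phi> (\<nu> ^ t * z i) - \<phi> (\<nu> ^ t * z a))))"
      if "i < N" "i \<notin> V" for i t
    proof -
      have "\<nu> ^ Suc t * z i = complex_of_real (lam l) * (\<nu> ^ t * z i
          - complex_of_real (kg l h) * (\<nu> ^ t * (\<mu> * z i)))"
        by (simp add: \<nu>_def algebra_simps)
      also have "\<nu> ^ t * (\<mu> * z i) =
          (\<Sum>a<N. complex_of_real (Adj i a) * (\<nu> ^ t * z i - \<nu> ^ t * z a))"
        unfolding zeig[OF that, symmetric] sum_distrib_left by (simp add: algebra_simps)
      finally show ?thesis by (simp add: of_real diff sum)
    qed
    then show ?thesis
      using closed_loop_on_leading_entry[OF conv jordan l h, where f="\<lambda>t i. \<phi> (\<nu> ^ t * z i)" and i=i] i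
      by (auto simp: V_def[symmetric] zV)
  qed
  define i where "i = s ! b0"
  have i: "i < N" "i \<notin> V" using nth_mem[of b0 s] b0 by (auto simp: i_def n_def s)
  have zi: "z i \<noteq> 0" using b0 by (simp add: i_def z_nth)
  have "(\<lambda>t. \<nu> ^ t * z i) \<longlonglongrightarrow> 0"
    using lim[OF bounded_linear_Re i] lim[OF bounded_linear_Im i]
    by (simp add: tendsto_complex_iff)
  then have "(\<lambda>t. cmod \<nu> ^ t * cmod (z i)) \<longlonglongrightarrow> 0"
    unfolding norm_power[symmetric] norm_mult[symmetric] by (rule tendsto_norm_zero)
  then obtain t where "cmod \<nu> ^ t * cmod (z i) < cmod (z i)"
    using LIMSEQ_D[of "\<lambda>t. cmod \<nu> ^ t * cmod (z i)" 0 "cmod (z i)"] zi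
    by (auto simp del: mult_less_cancel_right1)
  then have "cmod \<nu> ^ t < 1" using zi by simp
  then have "cmod \<nu> < 1" by (meson linorder_not_less one_le_power)
  moreover have "1 \<le> \<bar>lam l\<bar>" using jordan l by (auto simp: jordan_structure_def)
  moreover have "cmod \<nu> = cmod (1 - complex_of_real (kg l h) * \<mu>) * \<bar>lam l\<bar>"
    by (simp add: \<nu>_def norm_mult)
  ultimately show ?thesis by (simp add: pos_less_divide_eq)
qed

section \<open>Sufficiency and the equivalence\<close>

text \<open>The local errors vanish first. On an unstable block they are the errors of the agents in
  \<open>V3\<close>, which then act as vanishing inputs to the consensus errors of the
  others.\<close>

lemma observer_converges_if_gains:
  fixes Lg :: "nat \<Rightarrow> idx \<Rightarrow> nat \<Rightarrow> real"
  assumes jordan: "jordan_structure r ru lam g d"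
    and Lg: "\<forall>i<N. \<forall>e.
      (\<forall>t. \<forall>j\<in>Zset r ru g d p Cm i. e (Suc t) j = jordan_apply lam d (e t) j
        - (\<Sum>q<p i. Lg i j q * (\<Sum>j'\<in>Zset r ru g d p Cm i. Cm i q j' * e t j'))) \<longrightarrow>
      (\<forall>j\<in>Zset r ru g d p Cm i. (\<lambda>t. e t j) \<longlonglongrightarrow> 0)"
    and kg: "\<And>l h. l < ru \<Longrightarrow> h < g l \<Longrightarrow>
        \<forall>\<mu>\<in>spec (reduced_laplacian N Adj (V3 g d p Cm N l h)).
          cmod (1 - complex_of_real (kg l h) * \<mu>) < 1 / \<bar>lam l\<bar>"
    and cl: "closed_loop r ru lam g d m Bm N p Cm Adj Lg kg x u zh w"
    and i: "i < N" and j: "j \<in> coords r g d"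
  shows "(\<lambda>t. x t j - est ru g d p Cm zh w i t j) \<longlonglongrightarrow> 0"
proof -
  have x: "x (Suc t) j = jordan_apply lam d (x t) j + (\<Sum>c<m. Bm j c * u t c)"
    if "j \<in> coords r g d" for t j
    using cl that unfolding closed_loop_def by blast
  have zh: "zh i (Suc t) j = jordan_apply lam d (zh i t) j + (\<Sum>c<m. Bm j c * u t c)
      + (\<Sum>q<p i. Lg i j q * ((\<Sum>j'\<in>coords r g d. Cm i q j' * x t j')
            - (\<Sum>j'\<in>Zset r ru g d p Cm i. Cm i q j' * zh i t j')))"
    if "i < N" "j \<in> Zset r ru g d p Cm i" for i j t
    using cl that unfolding closed_loop_def by blast
  have w: "w i (Suc t) (l,h,k) = jordan_apply lam d (w i t) (l,h,k) + (\<Sum>c<m. Bm (l,h,k) c * u t c)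
      + kg l h * jordan_apply lam d
              (\<lambda>j'. \<Sum>a<N. Adj i a * (est ru g d p Cm zh w a t j' - w i t j')) (l,h,k)"
    if "i < N" "l < ru" "h < g l" "h \<notin> G3 g d p Cm i l" "k < d l h" for i t l h k
    using cl that unfolding closed_loop_def by blast
  \<comment> \<open>In the difference of plant and local observer the input cancels, and
    \<open>sum_Cm_Zset\<close> reduces the measurement to the kept coordinates, so the error
    recursion closes on \<open>Zset\<close>.\<close>
  have local: "(\<lambda>t. x t j - zh i t j) \<longlonglongrightarrow> 0"
    if i: "i < N" and j: "j \<in> Zset r ru g d p Cm i" for i j
  proof (rule Lg[THEN spec, THEN mp, OF i, THEN spec, THEN mp, THEN bspec, OF _ j], intro allI ballI)
    fix t j assume j: "j \<in> Zset r ru g d p Cm i"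
    then have "j \<in> coords r g d" by (auto simp: Zset_def)
    then show "x (Suc t) j - zh i (Suc t) j = jordan_apply lam d (\<lambda>j. x t j - zh i t j) j
          - (\<Sum>q<p i. Lg i j q * (\<Sum>j'\<in>Zset r ru g d p Cm i. Cm i q j' * (x t j' - zh i t j')))"
      using x zh[OF i j] by (simp add: jordan_apply_diff sum_Cm_Zset[where ru=ru] right_diff_distrib sum_subtractf)
  qed
  obtain l h k where jj: "j = (l,h,k)" by (cases j)
  have lhk: "l < r" "h < g l" "k < d l h" using j by (auto simp: jj coords_def)
  define E where "E i t \<kappa> = x t (l,h,\<kappa>) - est ru g d p Cm zh w i t (l,h,\<kappa>)" for i t \<kappa>
  show ?thesis
  proof (cases "l < ru")
    case False
    then show ?thesis using local[OF i, of j] j by (simp add: jj est_def Zset_iff)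
  next
    case True
    define D where "D i t \<kappa> = E i t \<kappa> - kg l h * (\<Sum>a<N. Adj i a * (E i t \<kappa> - E a t \<kappa>))" for i t \<kappa>
    have "(\<lambda>t. E i t k) \<longlonglongrightarrow> 0"
    proof (rule consensus_error_tendsto_zero[OF _ kg[OF True lhk(2)] _ D_def _ i lhk(3)])
      show "1 \<le> \<bar>lam l\<bar>" using jordan True by (auto simp: jordan_structure_def)
    next
      fix i \<kappa> assume "i < N" "i \<in> V3 g d p Cm N l h" "\<kappa> < d l h"
      then show "(\<lambda>t. E i t \<kappa>) \<longlonglongrightarrow> 0"
        using local[of i "(l,h,\<kappa>)"] lhk True
        by (simp add: E_def est_def V3_def Zset_iff coords_def tidx_eq_0_if_G3)
    next
      fix i t \<kappa> assume i: "i < N" and "i \<notin> V3 g d p Cm N l h" and \<kappa>: "\<kappa> < d l h"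
      then have h: "h \<notin> G3 g d p Cm i l" by (simp add: V3_def)
      have Ew: "E i t \<kappa> = x t (l,h,\<kappa>) - w i t (l,h,\<kappa>)" for t \<kappa>
        using True h by (simp add: E_def est_def)
      \<comment> \<open>All agents estimate the same plant state, so it cancels in the difference of
        two estimates and leaves a difference of errors.\<close>
      have "(\<Sum>a<N. Adj i a * (est ru g d p Cm zh w a t (l,h,\<kappa>) - w i t (l,h,\<kappa>))) =
          (\<Sum>a<N. Adj i a * (E i t \<kappa> - E a t \<kappa>))" for \<kappa>
        by (intro sum.cong refl, unfold Ew) (simp add: E_def)
      then show "E i (Suc t) \<kappa> = lam l * D i t \<kappa> + (if Suc \<kappa> < d l h then D i t (Suc \<kappa>) else 0)"
        using x[of "(l,h,\<kappa>)" t] w[OF i True lhk(2) h \<kappa>, of t] lhk \<kappa>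
        by (simp add: Ew[of "Suc t"] coords_def jordan_apply_def D_def)
           (simp add: Ew algebra_simps)
    qed
    then show ?thesis by (simp add: E_def jj)
  qed
qed

theorem theorem1:
  fixes r ru :: nat and lam :: "nat \<Rightarrow> real" and g :: "nat \<Rightarrow> nat"
    and d :: "nat \<Rightarrow> nat \<Rightarrow> nat" and m :: nat and Bm :: "idx \<Rightarrow> nat \<Rightarrow> real"
    and N :: nat and p :: "nat \<Rightarrow> nat" and Cm :: "nat \<Rightarrow> nat \<Rightarrow> idx \<Rightarrow> real"
    and Adj :: "nat \<Rightarrow> nat \<Rightarrow> real"
  assumes jordan: "jordan_structure r ru lam g d"
    and graph: "weighted_digraph N Adj"
    and A1: "detectable r lam g d N p Cm"
    and A2: "\<forall>i<N. \<forall>l<ru. lin_indep_family (p i) (G2 g d p Cm i l \<union> G3 g d p Cm i l)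
               (\<lambda>h q. if h \<in> G3 g d p Cm i l then Cm i q (l,h,0)
                      else Cm i q (l,h,tidx p Cm i l h))"
  shows "(\<exists>(Lg :: nat \<Rightarrow> idx \<Rightarrow> nat \<Rightarrow> real) (kg :: nat \<Rightarrow> nat \<Rightarrow> real).
            \<forall>x u zh w. closed_loop r ru lam g d m Bm N p Cm Adj Lg kg x u zh w \<longrightarrow>
              (\<forall>i<N. \<forall>j\<in>coords r g d.
                 (\<lambda>t. x t j - est ru g d p Cm zh w i t j) \<longlonglongrightarrow> 0))
         \<longleftrightarrow>
         (\<forall>l<ru. \<forall>h<g l. \<exists>k::real.
            \<forall>\<mu>\<in>spec (reduced_laplacian N Adj (V3 g d p Cm N l h)).
              cmod (1 - complex_of_real k * \<mu>) < 1 / \<bar>lam l\<bar>)"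
  (is "?observer \<longleftrightarrow> ?spectral")
proof
  assume ?observer
  then obtain Lg kg where "\<forall>x u zh w.
      closed_loop r ru lam g d m Bm N p Cm Adj Lg kg x u zh w \<longrightarrow>
        (\<forall>i<N. \<forall>j\<in>coords r g d. (\<lambda>t. x t j - est ru g d p Cm zh w i t j) \<longlonglongrightarrow> 0)"
    by (elim exE)
  note cond = spectral_condition_if_observer[OF this jordan]
  show ?spectral
  proof (intro allI impI)
    fix l h assume "l < ru" "h < g l"
    then show "\<exists>k. \<forall>\<mu>\<in>spec (reduced_laplacian N Adj (V3 g d p Cm N l h)).
        cmod (1 - complex_of_real k * \<mu>) < 1 / \<bar>lam l\<bar>"
      by (intro exI[of _ "kg l h"] ballI cond)
  qed
next
  assume ?spectral
  \<comment> \<open>The spectral condition treats each block separately, so the gains can be picked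
    block by block; values at other indices are arbitrary.\<close>
  define kg :: "nat \<Rightarrow> nat \<Rightarrow> real" where
    "kg l h = (SOME k. \<forall>\<mu>\<in>spec (reduced_laplacian N Adj (V3 g d p Cm N l h)).
        cmod (1 - complex_of_real k * \<mu>) < 1 / \<bar>lam l\<bar>)" for l h
  have kg: "\<forall>\<mu>\<in>spec (reduced_laplacian N Adj (V3 g d p Cm N l h)).
        cmod (1 - complex_of_real (kg l h) * \<mu>) < 1 / \<bar>lam l\<bar>" if "l < ru" "h < g l" for l h
    unfolding kg_def by (rule someI_ex) (use \<open>?spectral\<close> that in simp)
  have "\<forall>i. \<exists>Lg :: idx \<Rightarrow> nat \<Rightarrow> real. i < N \<longrightarrow> (\<forall>e.
      (\<forall>t. \<forall>j\<in>Zset r ru g d p Cm i. e (Suc t) j = jordan_apply lam d (e t) j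
        - (\<Sum>q<p i. Lg j q * (\<Sum>j'\<in>Zset r ru g d p Cm i. Cm i q j' * e t j'))) \<longrightarrow>
      (\<forall>j\<in>Zset r ru g d p Cm i. (\<lambda>t. e t j) \<longlonglongrightarrow> 0))"
    (is "\<forall>i. \<exists>Lg. i < N \<longrightarrow> ?P i Lg")
  proof
    fix i
    show "\<exists>Lg. i < N \<longrightarrow> ?P i Lg"
    proof (cases "i < N")
      case True
      then have "\<exists>Lg. ?P i Lg" using A2 by (intro luenberger_gain_exists[OF jordan]) simp
      then show ?thesis by (elim exE) (rule exI, rule impI)
    qed simp
  qed
  then obtain Lg :: "nat \<Rightarrow> idx \<Rightarrow> nat \<Rightarrow> real" where Lg: "\<forall>i<N. (\<forall>e.
      (\<forall>t. \<forall>j\<in>Zset r ru g d p Cm i. e (Suc t) j = jordan_apply lam d (e t) j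
        - (\<Sum>q<p i. Lg i j q * (\<Sum>j'\<in>Zset r ru g d p Cm i. Cm i q j' * e t j'))) \<longrightarrow>
      (\<forall>j\<in>Zset r ru g d p Cm i. (\<lambda>t. e t j) \<longlonglongrightarrow> 0))"
    by (rule choice[THEN exE])
  show ?observer
    by (intro exI[of _ Lg] exI[of _ kg] allI impI ballI)
      (rule observer_converges_if_gains[OF jordan Lg kg])
qed

end
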